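(* Let $G_2=\mathrm{Aut}(\mathbb{O})$ and $$M_4:=\{(W,J):\ W\in M_1',\ J\in\mathrm{SO}(W,n),\ J^2=-\mathrm{id}_W,\ J(X)\times J(Y)=X\times Y\ \ \forall X,Y\in W\}.$$ The group $G_2$ acts transitively on $M_4$ by $f\cdot(W,J)=(f(W),fJf^{-1})$. The isotropy subgroup of the element $(\mathbb{H}\mathbf{l},J_0)\in M_4$, where $J_0(q\mathbf{l})=(\mathbf{i}q)\mathbf{l}$ for $q\in\mathbb{H}$, is $H_4=\{f\in\mathrm{Aut}(\mathbb{O}): f\tau=\tau f\}$, and $H_4\cong\mathrm{U}(2)$. Hence $M_4\cong G_2/\mathrm{U}(2)$.
   Context: $\mathbb{O}=\mathbb{H}\oplus\mathbb{H}\mathbf{l}$ is the real octonion division algebra, where $\mathbb{H}=\langle 1,\mathbf{i},\mathbf{j},\mathbf{k}\rangle$ is the usual quaternion algebra, and for $q_1,q_2\in\mathbb{H}$: $q_1(q_2\mathbf{l})=(q_2q_1)\mathbf{l}$, $(q_2\mathbf{l})q_1=(q_2\overline{q_1})\mathbf{l}$, $(q_1\mathbf{l})(q_2\mathbf{l})=-\overline{q_2}q_1$. $n$ is the octonion norm (also its polar form, $n(x,x)=n(x)$), $\mathbb{O}_0=\{1\}^\perp\equiv\mathbb{R}^7$ the trace-zero octonions, $x\times y=\mathrm{pr}_{\mathbb{O}_0}(xy)$ the cross product on $\mathbb{O}_0$, and $\Omega(x,y,z)=n(x,y\times z)$. $\mathrm{Aut}(\mathbb{O})$ is the group of algebra automorphisms;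 its elements preserve $\mathbb{O}_0$, $n$ and $\times$. $M_1':=\{W\le\mathbb{O}_0:\ \dim W=4,\ \Omega(W,W,W)=0\}$. The automorphism $\tau\in\mathrm{Aut}(\mathbb{O})$ is $\tau(q_1+q_2\mathbf{l})=q_1+(\mathbf{i}q_2)\mathbf{l}$ for $q_1,q_2\in\mathbb{H}$. *)

theory Defs
  imports
    "HOL-Analysis.Analysis"
    "HOL-Algebra.Group_Action"
    "HOL-Algebra.Left_Coset"
begin

text \<open>
  The quadruple \<open>(a, b, c, d)\<close> is \<open>a + b i + c j + d k\<close>, and the pair \<open>(p, q)\<close> of quaternions
  is the octonion \<open>p + q l\<close>. The vector space structure and the topology are those of the
  product types.
\<close>

type_synonym quat = "real \<times> real \<times> real \<times> real"
type_synonym oct = "quat \<times> quat"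

fun qmult :: "quat \<Rightarrow> quat \<Rightarrow> quat" where
  "qmult (a, b, c, d) (a', b', c', d') =
     (a * a' - b * b' - c * c' - d * d',
      a * b' + b * a' + c * d' - d * c',
      a * c' - b * d' + c * a' + d * b',
      a * d' + b * c' - c * b' + d * a')"

fun qcnj :: "quat \<Rightarrow> quat" where
  "qcnj (a, b, c, d) = (a, - b, - c, - d)"

definition q1 :: quat where "q1 = (1, 0, 0, 0)"
definition qi :: quat where "qi = (0, 1, 0, 0)"

fun omult :: "oct \<Rightarrow> oct \<Rightarrow> oct" where
  "omult (p, q) (p', q') =
     (qmult p p' - qmult (qcnj q') q, qmult q' p + qmult q (qcnj p'))"

lemma qmult_zero [simp]: "qmult 0 q = 0" "qmult q 0 = 0" "qcnj 0 = 0"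
  by (cases q; simp add: zero_prod_def)+

text \<open>The rules that define the product of the sum of \<open>H\<close> and \<open>H l\<close>:\<close>

lemma omult_rules:
  "omult (p, 0) (p', 0) = (qmult p p', 0)"
  "omult (p, 0) (0, q) = (0, qmult q p)"
  "omult (0, q) (p, 0) = (0, qmult q (qcnj p))"
  "omult (0, q) (0, q') = (- qmult (qcnj q') q, 0)"
  by simp_all

definition o1 :: oct where "o1 = (q1, 0)"

definition ocnj :: "oct \<Rightarrow> oct" where "ocnj x = (qcnj (fst x), - snd x)"

text \<open>\<open>onrm x\<close> is the real number \<open>n(x)\<close> with \<open>x * conj x = n(x) 1\<close>; \<open>opol\<close> is the
  polar form of \<open>n\<close>, normalised so that \<open>n(x, x) = n(x)\<close>.\<close>

definition onrm :: "oct \<Rightarrow> real" where "onrm x = fst (fst (omult x (ocnj x)))"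

definition opol :: "oct \<Rightarrow> oct \<Rightarrow> real" where
  "opol x y = (onrm (x + y) - onrm x - onrm y) / 2"

definition Im_oct :: "oct set" where "Im_oct = {x. opol o1 x = 0}"

definition ocross :: "oct \<Rightarrow> oct \<Rightarrow> oct" where
  "ocross x y = omult x y - opol (omult x y) o1 *\<^sub>R o1"

definition Omega :: "oct \<Rightarrow> oct \<Rightarrow> oct \<Rightarrow> real" where
  "Omega x y z = opol x (ocross y z)"

definition G2 :: "(oct \<Rightarrow> oct) monoid" where
  "G2 = \<lparr>carrier = {f. linear f \<and> bij f \<and> (\<forall>x y. f (omult x y) = omult (f x) (f y))},
         mult = (\<circ>), one = id\<rparr>"

definition M1' :: "oct set set" where
  "M1' = {W. subspace W \<and> W \<subseteq> Im_oct \<and> dim W = 4 \<and>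
             (\<forall>x\<in>W. \<forall>y\<in>W. \<forall>z\<in>W. Omega x y z = 0)}"

text \<open>A linear endomorphism of a subspace \<open>W\<close> is represented by a function that is
  \<open>undefined\<close> outside \<open>W\<close>, so that distinct functions are distinct endomorphisms.\<close>

definition End_on :: "oct set \<Rightarrow> (oct \<Rightarrow> oct) set" where
  "End_on W = {J \<in> W \<rightarrow>\<^sub>E W. (\<forall>x\<in>W. \<forall>y\<in>W. J (x + y) = J x + J y) \<and>
                             (\<forall>c. \<forall>x\<in>W. J (c *\<^sub>R x) = c *\<^sub>R J x)}"

text \<open>Determinant of an endomorphism of a four-dimensional subspace: the determinant of its matrix
  in a basis \<open>b\<close> of \<open>W\<close>. It does not depend on \<open>b\<close>, which makes the definite description proper.\<close>

definition det4_on :: "oct set \<Rightarrow> (oct \<Rightarrow> oct) \<Rightarrow> real" where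
  "det4_on W J = (THE d. \<exists>(b :: 4 \<Rightarrow> oct) (A :: real^4^4).
      inj b \<and> independent (range b) \<and> span (range b) = W \<and>
      (\<forall>j. J (b j) = (\<Sum>i\<in>UNIV. A $ i $ j *\<^sub>R b i)) \<and> d = det A)"

definition SO4_on :: "oct set \<Rightarrow> (oct \<Rightarrow> oct) set" where
  "SO4_on W = {J \<in> End_on W. (\<forall>x\<in>W. \<forall>y\<in>W. opol (J x) (J y) = opol x y) \<and> det4_on W J = 1}"

definition M4 :: "(oct set \<times> (oct \<Rightarrow> oct)) set" where
  "M4 = {(W, J). W \<in> M1' \<and> J \<in> SO4_on W \<and> (\<forall>x\<in>W. J (J x) = - x) \<and>
                 (\<forall>x\<in>W. \<forall>y\<in>W. ocross (J x) (J y) = ocross x y)}"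

definition M4_act :: "(oct \<Rightarrow> oct) \<Rightarrow> oct set \<times> (oct \<Rightarrow> oct) \<Rightarrow> oct set \<times> (oct \<Rightarrow> oct)" where
  "M4_act f = (\<lambda>(W, J)\<in>M4. (f ` W, restrict (f \<circ> J \<circ> inv_into UNIV f) (f ` W)))"

definition Hl :: "oct set" where "Hl = {(0, q) | q. True}"

definition J0 :: "oct \<Rightarrow> oct" where "J0 = (\<lambda>x\<in>Hl. (0, qmult qi (snd x)))"

definition tau :: "oct \<Rightarrow> oct" where "tau x = (fst x, qmult qi (snd x))"

definition H4 :: "(oct \<Rightarrow> oct) set" where
  "H4 = {f \<in> carrier G2. f \<circ> tau = tau \<circ> f}"

definition cadjoint :: "complex^'n^'m \<Rightarrow> complex^'m^'n" where
  "cadjoint A = (\<chi> i j. cnj (A $ j $ i))"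

definition U2 :: "(complex^2^2) monoid" where
  "U2 = \<lparr>carrier = {A. A ** cadjoint A = mat 1 \<and> cadjoint A ** A = mat 1},
         mult = (**), one = mat 1\<rparr>"

text \<open>Sets of linear maps carry the topology of pointwise convergence (the topology of the type
  of functions), which for linear endomorphisms of a finite-dimensional space is the usual one.
  A pair \<open>(W, J)\<close> in \<open>M4\<close> is located by the orthogonal projection onto \<open>W\<close>, as in the usual
  description of the Grassmannian, and by the composition of \<open>J\<close> with this projection.\<close>

definition oproj :: "oct set \<Rightarrow> oct \<Rightarrow> oct" where
  "oproj W x = (THE w. w \<in> W \<and> (\<forall>v\<in>W. opol (x - w) v = 0))"

definition M4_top :: "(oct set \<times> (oct \<Rightarrow> oct)) topology" where
  "M4_top = pullback_topology M4 (\<lambda>(W, J). (oproj W, J \<circ> oproj W)) euclidean"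

definition quotient_topology :: "'a topology \<Rightarrow> ('a \<Rightarrow> 'b) \<Rightarrow> 'b topology" where
  "quotient_topology X p =
     topology (\<lambda>U. U \<subseteq> p ` topspace X \<and> openin X {x \<in> topspace X. p x \<in> U})"

lemma openin_quotient_topology:
  "openin (quotient_topology X p) U \<longleftrightarrow>
     U \<subseteq> p ` topspace X \<and> openin X {x \<in> topspace X. p x \<in> U}"
proof -
  have "istopology (\<lambda>U. U \<subseteq> p ` topspace X \<and> openin X {x \<in> topspace X. p x \<in> U})"
    unfolding istopology_def
  proof (intro conjI allI impI)
    fix S T
    assume "S \<subseteq> p ` topspace X \<and> openin X {x \<in> topspace X. p x \<in> S}"
      and "T \<subseteq> p ` topspace X \<and> openin X {x \<in> topspace X. p x \<in> T}"
    moreover have "{x \<in> topspace X. p x \<in> S \<inter> T} =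
        {x \<in> topspace X. p x \<in> S} \<inter> {x \<in> topspace X. p x \<in> T}" by blast
    ultimately show "S \<inter> T \<subseteq> p ` topspace X" "openin X {x \<in> topspace X. p x \<in> S \<inter> T}"
      by auto
  next
    fix K
    assume K: "\<forall>S\<in>K. S \<subseteq> p ` topspace X \<and> openin X {x \<in> topspace X. p x \<in> S}"
    then show "\<Union>K \<subseteq> p ` topspace X" by blast
    have "{x \<in> topspace X. p x \<in> \<Union>K} = (\<Union>S\<in>K. {x \<in> topspace X. p x \<in> S})" by blast
    with K show "openin X {x \<in> topspace X. p x \<in> \<Union>K}" by (auto intro: openin_Union)
  qed
  then show ?thesis by (simp add: quotient_topology_def)
qed

definition G2_mod_H4_top :: "(oct \<Rightarrow> oct) set topology" where
  "G2_mod_H4_top = quotient_topology (top_of_set (carrier G2)) (\<lambda>f. f <#\<^bsub>G2\<^esub> H4)"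

end

theory Submission
  imports Defs
begin

text \<open>
  Given \<open>(W, J)\<close>, take a unit \<open>x \<in> W\<close> and a unit \<open>y \<in> W\<close> orthogonal to \<open>x\<close> and \<open>J x\<close>. Then
  \<open>u = - (J x) x\<close> and \<open>v = - y x\<close> are orthonormal imaginary octonions, \<open>x\<close> is orthogonal to
  \<open>1, u, v, u v\<close>, and Cayley--Dickson doubling gives an automorphism with \<open>i \<mapsto> u\<close>, \<open>j \<mapsto> v\<close>,
  \<open>l \<mapsto> x\<close>. It maps \<open>l, i l, j l, k l\<close> to \<open>x, J x, y, J y\<close>; the last value is where
  \<open>J X \<times> J Y = X \<times> Y\<close> enters. This gives transitivity.

  An automorphism is determined by its restriction to \<open>H l\<close>, which generates the octonions. If it
  commutes with \<open>\<tau>\<close>, the restriction is complex linear and unitary on \<open>H l = \<complex>\<^sup>2\<close>. Conversely a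
  unitary matrix with first column \<open>u\<close> and determinant \<open>\<lambda>\<close> acts on the quaternions \<open>z + w j\<close> by
  \<open>q \<mapsto> \<phi>(q) u\<close>, where \<open>\<phi>(z + w j) = z + \<lambda> w j\<close> is an automorphism, and this extends to
  \<open>p + q l \<mapsto> conj(u) \<phi>(p) u + (\<phi>(q) u) l\<close>.

  All bijections in question are continuous from a compact space to a Hausdorff space, because
  automorphisms are isometries.
\<close>

section \<open>Octonion algebra\<close>

text \<open>The polar form is the Euclidean inner product of the product type, so all later work is
  phrased with \<open>\<bullet>\<close>.\<close>

lemma opol_inner: "opol x y = x \<bullet> y"
  by (cases x rule: prod.exhaust, cases y rule: prod.exhaust)
     (auto simp: opol_def onrm_def ocnj_def algebra_simps)

text \<open>These rules would split quantified octonions into eight real coordinates.\<close>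

declare split_paired_All [simp del] split_paired_Ex [simp del]

lemma bilinear_omult: "bilinear omult"
  unfolding bilinear_def
  by (intro conjI allI linearI) (auto simp: algebra_simps)

lemmas omult_bilinear_simps =
  bilinear_ladd[OF bilinear_omult] bilinear_radd[OF bilinear_omult]
  bilinear_lmul[OF bilinear_omult] bilinear_rmul[OF bilinear_omult]
  bilinear_lneg[OF bilinear_omult] bilinear_rneg[OF bilinear_omult]
  bilinear_lsub[OF bilinear_omult] bilinear_rsub[OF bilinear_omult]
  bilinear_lzero[OF bilinear_omult] bilinear_rzero[OF bilinear_omult]

lemma o1_omult [simp]: "omult o1 x = x" "omult x o1 = x"
  by (cases x rule: prod.exhaust; auto simp: o1_def q1_def)+

lemma o1_inner_o1 [simp]: "o1 \<bullet> o1 = 1"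
  by (simp add: o1_def q1_def)

lemma o1_neq_0 [simp]: "o1 \<noteq> 0"
  using o1_inner_o1 by force

text \<open>With this form, conjugates of imaginary or orthogonal octonions simplify without
  coordinates.\<close>

lemma ocnj_eq: "ocnj x = (2 * (x \<bullet> o1)) *\<^sub>R o1 - x"
  by (cases x rule: prod.exhaust) (auto simp: ocnj_def o1_def q1_def)

lemma ocnj_ocnj [simp]: "ocnj (ocnj x) = x"
  by (simp add: ocnj_eq inner_diff_left)

lemma ocnj_imaginary: "x \<bullet> o1 = 0 \<Longrightarrow> ocnj x = - x"
  by (simp add: ocnj_eq)

lemma ocnj_omult: "ocnj (omult a b) = omult (ocnj b) (ocnj a)"
  by (cases a rule: prod.exhaust, cases b rule: prod.exhaust)
    (auto simp: ocnj_def algebra_simps)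

lemma inner_omult_left: "omult a b \<bullet> c = b \<bullet> omult (ocnj a) c"
  by (cases a rule: prod.exhaust, cases b rule: prod.exhaust, cases c rule: prod.exhaust)
    (auto simp: ocnj_def algebra_simps)

lemma inner_omult_right: "omult a b \<bullet> c = a \<bullet> omult c (ocnj b)"
  by (cases a rule: prod.exhaust, cases b rule: prod.exhaust, cases c rule: prod.exhaust)
    (auto simp: ocnj_def algebra_simps)

lemma omult_ocnj_left: "omult (ocnj a) (omult a y) = (a \<bullet> a) *\<^sub>R y"
  by (cases a rule: prod.exhaust, cases y rule: prod.exhaust)
    (auto simp: ocnj_def algebra_simps)

lemma omult_ocnj_right: "omult (omult y a) (ocnj a) = (a \<bullet> a) *\<^sub>R y"
  by (cases a rule: prod.exhaust, cases y rule: prod.exhaust)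
    (auto simp: ocnj_def algebra_simps)

lemma ocnj_add: "ocnj (x + y) = ocnj x + ocnj y"
  by (simp add: ocnj_eq algebra_simps)

text \<open>Linearisation of \<open>omult_ocnj_left\<close>: expand it at \<open>a + b\<close> and
  remove the two pure terms.\<close>

lemma omult_ocnj_left_polar:
  "omult (ocnj a) (omult b y) + omult (ocnj b) (omult a y) = (2 * (a \<bullet> b)) *\<^sub>R y"
  using omult_ocnj_left[of "a + b" y] omult_ocnj_left[of a y] omult_ocnj_left[of b y]
  by (simp add: ocnj_add omult_bilinear_simps inner_commute algebra_simps)

lemma omult_ocnj_right_polar:
  "omult (omult y a) (ocnj b) + omult (omult y b) (ocnj a) = (2 * (a \<bullet> b)) *\<^sub>R y"
  using omult_ocnj_right[of y "a + b"] omult_ocnj_right[of y a] omult_ocnj_right[of y b]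
  by (simp add: ocnj_add omult_bilinear_simps inner_commute algebra_simps)

text \<open>Multiplicativity of the norm, polarised: the adjoint of multiplication by
  \<open>a\<close> is multiplication by its conjugate, and alternativity cancels the two.\<close>

lemma inner_omult_same_left: "omult a b \<bullet> omult a c = (a \<bullet> a) * (b \<bullet> c)"
  by (simp add: inner_omult_left omult_ocnj_left)

lemma inner_omult_same_right: "omult b a \<bullet> omult c a = (a \<bullet> a) * (b \<bullet> c)"
  by (simp add: inner_omult_right omult_ocnj_right)

lemma inner_omult_o1: "omult a b \<bullet> o1 = a \<bullet> ocnj b"
  by (simp add: inner_omult_right)

lemma omult_self: "omult x x = (2 * (x \<bullet> o1)) *\<^sub>R x - (x \<bullet> x) *\<^sub>R o1"
  using omult_ocnj_left[of x o1] by (simp add: ocnj_eq omult_bilinear_simps algebra_simps)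

lemma omult_imaginary_left:
  "x \<bullet> o1 = 0 \<Longrightarrow> omult x (omult x y) = - ((x \<bullet> x) *\<^sub>R y)"
  using omult_ocnj_left[of x y]
  by (simp add: ocnj_imaginary omult_bilinear_simps) (metis minus_minus)

lemma omult_imaginary_right:
  "x \<bullet> o1 = 0 \<Longrightarrow> omult (omult y x) x = - ((x \<bullet> x) *\<^sub>R y)"
  using omult_ocnj_right[of y x]
  by (simp add: ocnj_imaginary omult_bilinear_simps) (metis minus_minus)

text \<open>\<open>omult b x\<close> is imaginary, hence minus its own conjugate, and conjugation
  reverses the factors.\<close>

lemma omult_orthogonal_commute:
  assumes "x \<bullet> o1 = 0" "x \<bullet> b = 0"
  shows "omult b x = omult x (ocnj b)"
proof -
  have "omult b x \<bullet> o1 = 0"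
    using assms by (simp add: inner_omult_o1 ocnj_imaginary inner_commute[of b x])
  then have "omult b x = - ocnj (omult b x)"
    by (simp add: ocnj_eq)
  then show ?thesis
    using assms by (simp add: ocnj_omult ocnj_imaginary omult_bilinear_simps)
qed

lemma omult_imaginary_anticommute:
  assumes "a \<bullet> o1 = 0" "b \<bullet> o1 = 0" "a \<bullet> b = 0"
  shows "omult b a = - omult a b"
  using omult_orthogonal_commute[of a b] assms
  by (simp add: ocnj_imaginary omult_bilinear_simps)

text \<open>The three rules below are those of the Cayley--Dickson doubling; they hold for \<open>a, b\<close> in a
  subalgebra closed under conjugation and an imaginary unit \<open>x\<close> orthogonal to it.\<close>

lemma cayley_dickson_1:
  assumes x: "x \<bullet> o1 = 0" "x \<bullet> a = 0" "x \<bullet> b = 0" "x \<bullet> omult b a = 0"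
  shows "omult a (omult b x) = omult (omult b a) x"
proof -
  have "ocnj a \<bullet> x = 0"
    using x by (simp add: ocnj_eq inner_diff_left inner_commute[of a x] inner_commute[of o1 x])
  \<comment> \<open>In the polarised identity for \<open>ocnj a\<close> and \<open>x\<close> the
    right side vanishes by orthogonality, so left multiplication by \<open>a\<close> passes
    \<open>x\<close> at the price of a conjugation.\<close>
  then have *: "omult a (omult x y) = omult x (omult (ocnj a) y)" for y
    using omult_ocnj_left_polar[of "ocnj a" x y] x
    by (simp add: ocnj_imaginary omult_bilinear_simps)
  have "omult a (omult b x) = omult a (omult x (ocnj b))"
    using x by (simp add: omult_orthogonal_commute)
  also have "\<dots> = omult x (ocnj (omult b a))"
    by (simp add: * ocnj_omult)
  also have "\<dots> = omult (omult b a) x"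
    using x by (simp add: omult_orthogonal_commute)
  finally show ?thesis .
qed

lemma cayley_dickson_2:
  assumes x: "x \<bullet> o1 = 0" "x \<bullet> a = 0" "x \<bullet> b = 0" "x \<bullet> omult b a = 0"
    "x \<bullet> omult a (ocnj b) = 0"
  shows "omult (omult a x) b = omult (omult a (ocnj b)) x"
proof -
  have xb: "x \<bullet> ocnj b = 0"
    using x by (simp add: ocnj_eq inner_diff_right)
  \<comment> \<open>This product is imaginary, hence minus its conjugate; reversing the factors
    reduces the rule to \<open>cayley_dickson_1\<close> for \<open>ocnj b\<close> and
    \<open>a\<close>.\<close>
  have "omult (omult a x) b \<bullet> o1 = omult a x \<bullet> ocnj b"
    by (rule inner_omult_o1)
  also have "\<dots> = x \<bullet> ocnj (omult b a)"
    by (simp add: inner_omult_left ocnj_omult)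
  also have "\<dots> = 0"
    using x by (simp add: ocnj_eq inner_diff_right)
  finally have "omult (omult a x) b = - ocnj (omult (omult a x) b)"
    by (simp add: ocnj_eq)
  also have "\<dots> = omult (ocnj b) (omult x (ocnj a))"
    using x by (simp add: ocnj_omult ocnj_imaginary omult_bilinear_simps)
  also have "\<dots> = omult (ocnj b) (omult a x)"
    using x by (simp add: omult_orthogonal_commute)
  also have "\<dots> = omult (omult a (ocnj b)) x"
    using x xb by (intro cayley_dickson_1)
  finally show ?thesis .
qed

lemma cayley_dickson_3:
  assumes x: "x \<bullet> o1 = 0" "x \<bullet> a = 0" "x \<bullet> b = 0" "x \<bullet> omult b a = 0" "x \<bullet> x = 1"
  shows "omult (omult a x) (omult b x) = - omult (ocnj b) a"
proof -
  have c: "ocnj (omult b x) = - omult b x"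
    using x by (intro ocnj_imaginary) (simp add: inner_omult_o1 ocnj_imaginary inner_commute[of b x])
  then have c': "ocnj (- omult b x) = omult b x"
    by (metis ocnj_ocnj)
  have "x \<bullet> omult b x = b \<bullet> o1"
    using inner_omult_same_right[of o1 x b] x by (simp add: inner_commute)
  \<comment> \<open>The polarised right identity for \<open>x\<close> and
    \<open>- omult b x\<close>, both imaginary. The first rule evaluates the second summand, and
    \<open>2 (b \<bullet> o1) - b\<close> is the conjugate of \<open>b\<close>.\<close>
  then have "omult (omult a x) (omult b x) + omult (omult a (omult b x)) x
      = - ((2 * (b \<bullet> o1)) *\<^sub>R a)"
    using omult_ocnj_right_polar[of a x "- omult b x"] x c'
    by (simp add: ocnj_imaginary omult_bilinear_simps)
  moreover have "omult (omult a (omult b x)) x = - omult b a"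
    using x by (simp add: cayley_dickson_1 omult_imaginary_right)
  ultimately show ?thesis
    by (simp add: ocnj_eq omult_bilinear_simps algebra_simps add_eq_0_iff2)
qed

section \<open>Automorphisms\<close>

text \<open>Bijectivity is traded for fixing the unit. A surjective multiplicative map sends the
  unit to the unit; conversely, applying \<open>f\<close> to conj(x) x = n(x) 1 shows that the
  kernel is trivial, and finite dimension gives surjectivity.\<close>

lemma G2_iff:
  "f \<in> carrier G2 \<longleftrightarrow>
     linear f \<and> (\<forall>x y. f (omult x y) = omult (f x) (f y)) \<and> f o1 = o1"
proof
  assume f: "f \<in> carrier G2"
  then have lin: "linear f" and "surj f" and mult: "\<And>x y. f (omult x y) = omult (f x) (f y)"
    by (simp_all add: G2_def bij_def)
  then obtain y where "o1 = f y"
    by (meson surjE)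
  then have "f o1 = o1"
    using mult[of y o1] by simp
  with f show "linear f \<and> (\<forall>x y. f (omult x y) = omult (f x) (f y)) \<and> f o1 = o1"
    by (simp add: G2_def)
next
  assume f: "linear f \<and> (\<forall>x y. f (omult x y) = omult (f x) (f y)) \<and> f o1 = o1"
  have "x = 0" if "f x = 0" for x
  proof -
    have "(x \<bullet> x) *\<^sub>R o1 = omult (f (ocnj x)) (f x)"
      using f omult_ocnj_left[of x o1] linear_cmul[of f "x \<bullet> x" o1] by (metis o1_omult(2))
    then show ?thesis
      using that by (simp add: omult_bilinear_simps)
  qed
  then have "inj f"
    using f linear_injective_0 by blast
  with f show "f \<in> carrier G2"
    by (auto simp: G2_def bij_def linear_injective_imp_surjective)
qed

lemma G2D:
  assumes "f \<in> carrier G2"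
  shows "linear f" "bij f" "f (omult x y) = omult (f x) (f y)" "f o1 = o1"
  using assms G2_iff by (auto simp: G2_def)

text \<open>The norm can be read off from the product: an imaginary \<open>x\<close> has square -
  n(x) 1, an equation that \<open>f\<close> preserves. The real part is fixed and splits off
  orthogonally.\<close>

lemma G2_orthogonal_transformation:
  assumes f: "f \<in> carrier G2"
  shows "orthogonal_transformation f"
proof -
  \<comment> \<open>Imaginary octonions are the zero and the non-real ones whose square is real.\<close>
  have im: "f x \<bullet> o1 = 0 \<and> f x \<bullet> f x = x \<bullet> x" if x: "x \<bullet> o1 = 0" for x
  proof -
    have "omult (f x) (f x) = - ((x \<bullet> x) *\<^sub>R o1)"
      using omult_self[of x] x
      by (simp add: linear_cmul[OF G2D(1)[OF f]] linear_neg[OF G2D(1)[OF f]] G2D(4)[OF f]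
          flip: G2D(3)[OF f])
    then have e: "(2 * (f x \<bullet> o1)) *\<^sub>R f x = (f x \<bullet> f x - x \<bullet> x) *\<^sub>R o1"
      using omult_self[of "f x"] by (simp add: algebra_simps)
    \<comment> \<open>Otherwise \<open>e\<close> makes \<open>f x\<close> a real multiple of
      \<open>o1\<close>, the image of that same multiple; injectivity then makes \<open>x\<close>
      both real and imaginary.\<close>
    have "f x \<bullet> o1 = 0"
    proof (rule ccontr)
      assume n: "f x \<bullet> o1 \<noteq> 0"
      define c where "c = (f x \<bullet> f x - x \<bullet> x) / (2 * (f x \<bullet> o1))"
      have "f x = (1 / (2 * (f x \<bullet> o1))) *\<^sub>R ((2 * (f x \<bullet> o1)) *\<^sub>R f x)"
        using n by simp
      also have "\<dots> = c *\<^sub>R o1"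
        unfolding e by (simp add: c_def)
      also have "\<dots> = f (c *\<^sub>R o1)"
        using G2D[OF f] by (simp add: linear_cmul)
      finally have "x = c *\<^sub>R o1"
        using G2D(2)[OF f] by (simp add: bij_def inj_eq)
      then have "x = 0" using x by auto
      then show False using n G2D(1)[OF f] by (simp add: linear_0)
    qed
    with e show ?thesis by simp
  qed
  have "f x \<bullet> f x = x \<bullet> x" for x
  proof -
    define y where "y = x - (x \<bullet> o1) *\<^sub>R o1"
    have x: "x = (x \<bullet> o1) *\<^sub>R o1 + y" by (simp add: y_def)
    have y: "y \<bullet> o1 = 0" by (simp add: y_def inner_diff_left)
    have fx: "f x = (x \<bullet> o1) *\<^sub>R o1 + f y"
      using arg_cong[OF x, of f]
      by (simp only: linear_add[OF G2D(1)[OF f]] linear_cmul[OF G2D(1)[OF f]] G2D(4)[OF f])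
    have *: "(t *\<^sub>R o1 + z) \<bullet> (t *\<^sub>R o1 + z) = t * t + z \<bullet> z" if "z \<bullet> o1 = 0" for t z
      using that by (simp add: inner_add inner_commute)
    show ?thesis
      using *[of y "x \<bullet> o1"] *[of "f y" "x \<bullet> o1"] im[OF y] y
      by (simp add: fx[symmetric] x[symmetric])
  qed
  then show ?thesis
    using G2D(1)[OF f] by (simp add: orthogonal_transformation norm_eq)
qed

lemma G2_inner: "f \<in> carrier G2 \<Longrightarrow> f x \<bullet> f y = x \<bullet> y"
  using G2_orthogonal_transformation by (simp add: orthogonal_transformation_def)

lemma G2_norm: "f \<in> carrier G2 \<Longrightarrow> norm (f x) = norm x"
  using G2_orthogonal_transformation by (simp add: orthogonal_transformation)

section \<open>Automorphisms from orthonormal triples\<close>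

definition qmap :: "oct \<Rightarrow> oct \<Rightarrow> quat \<Rightarrow> oct" where
  "qmap u v = (\<lambda>(a, b, c, d). a *\<^sub>R o1 + b *\<^sub>R u + c *\<^sub>R v + d *\<^sub>R omult u v)"

lemma linear_qmap: "linear (qmap u v)"
  by (rule linearI) (auto simp: qmap_def algebra_simps)

context
  fixes u v :: oct
  assumes u: "u \<bullet> o1 = 0" "u \<bullet> u = 1" and v: "v \<bullet> o1 = 0" "v \<bullet> v = 1" and uv: "u \<bullet> v = 0"
begin

lemma imaginary_omult: "omult u v \<bullet> o1 = 0"
  using u v uv by (simp add: inner_omult_o1 ocnj_imaginary)

text \<open>Orthonormal imaginary \<open>u\<close>, \<open>v\<close> square to -1 and anticommute.
  Alternativity replaces associativity in the products that involve \<open>omult u v\<close>, so the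
  quaternion multiplication table results.\<close>

lemma qmap_qmult: "qmap u v (qmult p q) = omult (qmap u v p) (qmap u v q)"
proof -
  have vu: "omult v u = - omult u v"
    using u v uv by (intro omult_imaginary_anticommute)
  have sq: "omult u u = - o1" "omult v v = - o1"
    using u v by (simp_all add: omult_self)
  have l: "omult u (omult u w) = - w" "omult v (omult v w) = - w"
     "omult (omult w u) u = - w"  "omult (omult w v) v = - w" for w
    using u v by (simp_all add: omult_imaginary_left omult_imaginary_right)
  have m: "omult v (omult u v) = u" "omult (omult u v) u = v"
    using l(2)[of u] l(3)[of v] by (simp_all add: vu omult_bilinear_simps)
  have n: "omult (omult u v) (omult u v) = - o1"
    using u v imaginary_omult by (simp add: omult_self inner_omult_same_left)
  show ?thesis
    by (cases p rule: prod_cases4, cases q rule: prod_cases4)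
      (simp add: qmap_def omult_bilinear_simps vu sq l m n algebra_simps)
qed

lemma qmap_qcnj: "qmap u v (qcnj p) = ocnj (qmap u v p)"
  using u v imaginary_omult
  by (cases p rule: prod_cases4) (simp add: qmap_def ocnj_eq inner_add_left algebra_simps,
      simp flip: scaleR_left_distrib)

text \<open>The image of \<open>qmap u v\<close> is closed under product and conjugation and
  orthogonal to \<open>x\<close>. The Cayley-Dickson rules therefore hold for it, and they reproduce
  the terms of \<open>omult\<close> one by one.\<close>

lemma triple_automorphism:
  assumes x: "x \<bullet> o1 = 0" "x \<bullet> x = 1" "x \<bullet> u = 0" "x \<bullet> v = 0" "x \<bullet> omult u v = 0"
  shows "(\<lambda>(p, q). qmap u v p + omult (qmap u v q) x) \<in> carrier G2"
proof -
  let ?h = "qmap u v"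
  have xh: "x \<bullet> ?h p = 0" for p
    using x by (cases p rule: prod_cases4) (simp add: qmap_def inner_add_right)
  have xhh: "x \<bullet> omult (?h p) (?h q) = 0" for p q
    by (metis xh qmap_qmult)
  have xhc: "x \<bullet> omult (?h p) (ocnj (?h q)) = 0" for p q
    by (metis xhh qmap_qcnj)
  note h = linear_add[OF linear_qmap] linear_cmul[OF linear_qmap] linear_diff[OF linear_qmap]
  have o: "?h q1 = o1" "?h 0 = 0"
    by (simp_all add: qmap_def q1_def zero_prod_def)
  have 1: "omult (?h a) (omult (?h b) x) = omult (omult (?h b) (?h a)) x" for a b
    using x xh xhh by (intro cayley_dickson_1)
  have 2: "omult (omult (?h a) x) (?h b) = omult (omult (?h a) (ocnj (?h b))) x" for a b
    using x xh xhh xhc by (intro cayley_dickson_2)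
  have 3: "omult (omult (?h a) x) (omult (?h b) x) = - omult (ocnj (?h b)) (?h a)" for a b
    using x xh xhh by (intro cayley_dickson_3)
  show ?thesis
    unfolding G2_iff
  proof (intro conjI allI)
    show "linear (\<lambda>(p, q). ?h p + omult (?h q) x)"
      by (rule linearI) (simp_all add: case_prod_beta h omult_bilinear_simps algebra_simps)
    show "(case o1 of (p, q) \<Rightarrow> ?h p + omult (?h q) x) = o1"
      by (subst o1_def) (simp add: o omult_bilinear_simps)
    fix y z :: oct
    show "(case omult y z of (p, q) \<Rightarrow> ?h p + omult (?h q) x) =
      omult (case y of (p, q) \<Rightarrow> ?h p + omult (?h q) x) (case z of (p, q) \<Rightarrow> ?h p + omult (?h q) x)"
    proof (cases y rule: prod.exhaust, cases z rule: prod.exhaust)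
      fix p q p' q' assume yz: "y = (p, q)" "z = (p', q')"
      have "omult (?h p + omult (?h q) x) (?h p' + omult (?h q') x) =
        omult (?h p) (?h p') + omult (?h p) (omult (?h q') x) +
        (omult (omult (?h q) x) (?h p') + omult (omult (?h q) x) (omult (?h q') x))"
        by (simp only: bilinear_ladd[OF bilinear_omult] bilinear_radd[OF bilinear_omult] add_ac)
      also have "\<dots> = omult (?h p) (?h p') + omult (omult (?h q') (?h p)) x +
        (omult (omult (?h q) (ocnj (?h p'))) x + - omult (ocnj (?h q')) (?h q))"
        by (simp only: 1 2 3)
      also have "\<dots> = ?h (qmult p p' - qmult (qcnj q') q) +
        omult (?h (qmult q' p + qmult q (qcnj p'))) x"
        by (simp only: h bilinear_ladd[OF bilinear_omult] qmap_qmult qmap_qcnj) simp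
      finally show ?thesis
        by (simp only: yz omult.simps prod.case)
    qed
  qed
qed

end

section \<open>Determinants of complex structures\<close>

text \<open>\<open>det (cos t + sin t A)\<close> has no zero, so it stays positive from \<open>t = 0\<close> to \<open>t = \<pi>/2\<close>.\<close>

lemma det_eq_1_if_square_minus_1:
  fixes A :: "real^'n^'n"
  assumes A: "A ** A = - mat 1"
  shows "det A = 1"
proof -
  \<comment> \<open>\<open>F t\<close> is exp(t A), as \<open>A\<close> squares to -1. It is a
    one-parameter group, so each \<open>F t\<close> has the inverse \<open>F (- t)\<close>.\<close>
  define F where "F t = cos t *\<^sub>R mat 1 + sin t *\<^sub>R A" for t
  have mult: "F s ** F t = F (s + t)" for s t
  proof -
    have *: "F t *v x = cos t *\<^sub>R x + sin t *\<^sub>R (A *v x)" for t x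
      by (simp add: F_def matrix_vector_mult_add_rdistrib flip: scaleR_matrix_vector_assoc)
    have "A *v (A *v x) = - x" for x
      using matrix_vector_mult_diff_rdistrib[of 0 "mat 1" x]
      by (simp add: matrix_vector_mul_assoc A)
    then show ?thesis
      by (simp add: matrix_eq * cos_add sin_add algebra_simps flip: matrix_vector_mul_assoc)
  qed
  have "F 0 = mat 1"
    by (simp add: F_def)
  with mult have nz: "det (F t) \<noteq> 0" for t
    by (metis add.right_inverse det_I det_mul mult_zero_left zero_neq_one)
  have cont: "continuous_on {0..pi/2} (\<lambda>t. det (F t))"
    unfolding det_def F_def by (intro continuous_intros)
  have "det A > 0"
  proof (rule ccontr)
    assume "\<not> det A > 0"
    then have "\<exists>t\<ge>0. t \<le> pi/2 \<and> det (F t) = 0"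
      using cont by (intro IVT2') (auto simp: F_def)
    with nz show False by blast
  qed
  \<comment> \<open>\<open>A\<close> is \<open>F (pi/2)\<close>, so its fourth power is
    \<open>F (2 * pi)\<close>, the identity.\<close>
  moreover have "(det A)^4 = 1"
  proof -
    have "A = F (pi/2)" "F (2 * pi) = mat 1"
      by (simp_all add: F_def)
    then have "(A ** A) ** (A ** A) = mat 1"
      by (simp add: mult)
    then have "det A * det A * (det A * det A) = 1"
      by (metis det_I det_mul)
    then show ?thesis by (simp add: power4_eq_xxxx mult.assoc)
  qed
  ultimately show ?thesis
    by (metis less_eq_real_def power_eq_1_iff real_norm_def abs_of_pos zero_neq_numeral)
qed

lemma End_on_sum:
  assumes J: "J \<in> End_on W" and W: "subspace W" and b: "\<And>i. i \<in> S \<Longrightarrow> b i \<in> W"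
  shows "J (\<Sum>i\<in>S. c i *\<^sub>R b i) = (\<Sum>i\<in>S. c i *\<^sub>R J (b i))"
proof -
  \<comment> \<open>Covers the empty sum and also the infinite one, whose value is 0 by
    convention.\<close>
  have J0: "J 0 = 0"
    using J subspace_0[OF W] unfolding End_on_def by (metis (mono_tags, lifting) mem_Collect_eq scaleR_zero_left)
  show ?thesis
    using b
  proof (induction S rule: infinite_finite_induct)
  case (insert i S)
  then have "(\<Sum>i\<in>S. c i *\<^sub>R b i) \<in> W" "c i *\<^sub>R b i \<in> W"
    using W by (auto intro!: subspace_sum subspace_mul)
  with insert J show ?case
    by (simp add: End_on_def)
  qed (simp_all add: J0)
qed

text \<open>Comparing coordinates in \<open>J (J (b j)) = - b j\<close> gives
  \<open>A ** A = - mat 1\<close>.\<close>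

lemma det_complex_structure:
  assumes J: "J \<in> End_on W" and W: "subspace W" and JJ: "\<And>x. x \<in> W \<Longrightarrow> J (J x) = - x"
    and b: "inj b" "independent (range b)" "span (range b) = W"
    and A: "\<And>j. J (b j) = (\<Sum>i\<in>UNIV. A $ i $ j *\<^sub>R b i)"
  shows "det A = 1"
proof -
  have bW: "b i \<in> W" for i
    using span_base[of "b i" "range b"] b(3) by auto
  have "(A ** A) $ k $ j = - mat 1 $ k $ j" for k j
  proof -
    have "- b j = J (J (b j))"
      using bW JJ by simp
    also have "\<dots> = J (\<Sum>i\<in>UNIV. A $ i $ j *\<^sub>R b i)"
      by (simp only: A)
    also have "\<dots> = (\<Sum>i\<in>UNIV. A $ i $ j *\<^sub>R J (b i))"
      using bW by (intro End_on_sum[OF J W])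
    also have "\<dots> = (\<Sum>i\<in>UNIV. \<Sum>k\<in>UNIV. (A $ k $ i * A $ i $ j) *\<^sub>R b k)"
      by (simp add: A scaleR_sum_right mult.commute)
    also have "\<dots> = (\<Sum>k\<in>UNIV. (A ** A) $ k $ j *\<^sub>R b k)"
      by (subst sum.swap) (simp add: matrix_matrix_mult_def scaleR_sum_left)
    finally have "(\<Sum>k\<in>UNIV. (A ** A) $ k $ j *\<^sub>R b k) + b j = 0"
      by (metis add.left_inverse)
    moreover have "b j = (\<Sum>k\<in>UNIV. mat 1 $ k $ j *\<^sub>R b k)"
      by (simp add: mat_def if_distrib[of "\<lambda>c. c *\<^sub>R _"] cong: if_cong)
    ultimately have "(\<Sum>k\<in>UNIV. ((A ** A) $ k $ j + mat 1 $ k $ j) *\<^sub>R b k) = 0"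
      by (simp add: scaleR_left_distrib sum.distrib)
    \<comment> \<open>Independence speaks about the set \<open>range b\<close>, so the coefficients
      are reindexed by basis vectors through \<open>the_inv b\<close>.\<close>
    then have "(\<Sum>v\<in>range b. ((A ** A) $ the_inv b v $ j + mat 1 $ the_inv b v $ j) *\<^sub>R v) = 0"
      using b(1) by (simp add: sum.reindex the_inv_f_f)
    then have "(A ** A) $ the_inv b (b k) $ j + mat 1 $ the_inv b (b k) $ j = 0"
      by (intro independentD[OF b(2) _ subset_refl, where
            u = "\<lambda>v. (A ** A) $ the_inv b v $ j + mat 1 $ the_inv b v $ j"]) auto
    then show ?thesis
      using b(1) by (simp add: the_inv_f_f add_eq_0_iff2)
  qed
  then have "A ** A = - mat 1"
    by (simp add: vec_eq_iff)
  then show ?thesis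
    by (rule det_eq_1_if_square_minus_1)
qed

text \<open>A basis of \<open>W\<close> exists, and in every basis the matrix of \<open>J\<close>
  has determinant 1, so the definite description has exactly this value.\<close>

lemma det4_on_complex_structure:
  assumes J: "J \<in> End_on W" and W: "subspace W" "dim W = 4" and JJ: "\<And>x. x \<in> W \<Longrightarrow> J (J x) = - x"
  shows "det4_on W J = 1"
  unfolding det4_on_def
proof (rule the_equality)
  note det = det_complex_structure[OF J W(1) JJ]
  obtain B where B: "B \<subseteq> W" "independent B" "W \<subseteq> span B" "card B = dim W"
    using basis_exists by blast
  then have sB: "span B = W" and "finite B"
    using W by (metis span_minimal subset_antisym, metis independent_imp_finite)
  then obtain b :: "4 \<Rightarrow> oct" where "bij_betw b UNIV B"
    using finite_same_card_bij[of "UNIV :: 4 set" B] B W by auto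
  then have b: "inj b" "range b = B"
    by (auto simp: bij_betw_def)
  define A :: "real^4^4" where "A = (\<chi> i j. representation B (J (b j)) (b i))"
  have "J (b j) = (\<Sum>i\<in>UNIV. A $ i $ j *\<^sub>R b i)" for j
  proof -
    have "J (b j) \<in> span B"
      using J B b sB by (auto simp: End_on_def)
    then have "J (b j) = (\<Sum>v\<in>B. representation B (J (b j)) v *\<^sub>R v)"
      using sum_representation_eq[of B "J (b j)" B] B \<open>finite B\<close> by simp
    then show ?thesis
      by (simp add: A_def sum.reindex[OF b(1)] flip: b(2))
  qed
  moreover from this have "det A = 1"
    using b B sB by (intro det[of b A]) auto
  ultimately show "\<exists>(b :: 4 \<Rightarrow> oct) A. inj b \<and> independent (range b) \<and> span (range b) = W \<and>
      (\<forall>j. J (b j) = (\<Sum>i\<in>UNIV. A $ i $ j *\<^sub>R b i)) \<and> 1 = det A"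
    using b B sB by (intro exI[of _ b] exI[of _ A]) simp
  fix d assume "\<exists>(b :: 4 \<Rightarrow> oct) A. inj b \<and> independent (range b) \<and> span (range b) = W \<and>
      (\<forall>j. J (b j) = (\<Sum>i\<in>UNIV. A $ i $ j *\<^sub>R b i)) \<and> d = det A"
  then obtain b :: "4 \<Rightarrow> oct" and A where "inj b" "independent (range b)" "span (range b) = W"
    "\<And>j. J (b j) = (\<Sum>i\<in>UNIV. A $ i $ j *\<^sub>R b i)" "d = det A"
    by (elim exE conjE) simp
  then show "d = 1"
    using det[of b A] by simp
qed

section \<open>Orbits and quotient topologies\<close>

text \<open>The orbit-stabiliser map is produced together with its values on cosets, from which its
  equivariance and continuity are derived later.\<close>

lemma (in transitive_action) orbit_stabilizer_bij:
  assumes x: "x \<in> E"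
  obtains \<Phi> where "bij_betw \<Phi> (lcosets (stabilizer G \<phi> x)) E"
    "\<And>g. g \<in> carrier G \<Longrightarrow> \<Phi> (g <# stabilizer G \<phi> x) = \<phi> g x"
proof
  interpret group G
    using group_hom group_hom.axioms(1) by auto
  define H where "H = stabilizer G \<phi> x"
  have H: "subgroup H G"
    unfolding H_def using x by (rule stabilizer_subgroup)
  \<comment> \<open>A chosen representative defines the map; another representative differs by a
    factor in \<open>H\<close>, which fixes \<open>x\<close>.\<close>
  define \<Phi> where "\<Phi> C = \<phi> (SOME g. g \<in> C) x" for C
  have val: "\<Phi> (g <# H) = \<phi> g x" if g: "g \<in> carrier G" for g
  proof -
    have "(SOME k. k \<in> g <# H) \<in> g <# H"
      using lcos_self[OF g H] by (rule someI)
    then obtain h where "h \<in> H" "(SOME k. k \<in> g <# H) = g \<otimes> h"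
      by (auto simp: l_coset_def)
    then show ?thesis
      using g x by (simp add: \<Phi>_def H_def stabilizer_def composition_rule)
  qed
  then show "\<And>g. g \<in> carrier G \<Longrightarrow> \<Phi> (g <# stabilizer G \<phi> x) = \<phi> g x"
    by (simp add: H_def)
  have "inj_on \<Phi> (lcosets H)"
  proof (rule inj_onI)
    fix C D assume "C \<in> lcosets H" "D \<in> lcosets H" and eq: "\<Phi> C = \<Phi> D"
    then obtain g k where gk: "g \<in> carrier G" "C = g <# H" "k \<in> carrier G" "D = k <# H"
      by (auto simp: LCOSETS_def)
    then have "\<phi> g x = \<phi> k x"
      using eq val by simp
    then have "\<phi> (inv k \<otimes> g) x = x"
      using gk x by (metis composition_rule inv_closed orbit_sym_aux)
    then have "inv k \<otimes> g \<in> H"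
      using gk by (simp add: H_def stabilizer_def)
    then have "g \<in> k <# H"
      using gk subgroup.lcos_module_rev[OF H] by (metis group_axioms)
    then show "C = D"
      using gk l_repr_independence[OF _ _ H] by metis
  qed
  moreover have "\<Phi> ` (lcosets H) = E"
  proof
    show "\<Phi> ` (lcosets H) \<subseteq> E"
      using val x element_image by (auto simp: LCOSETS_def)
    show "E \<subseteq> \<Phi> ` (lcosets H)"
    proof
      fix y assume "y \<in> E"
      then obtain g where "g \<in> carrier G" "\<phi> g x = y"
        using unique_orbit x by blast
      then show "y \<in> \<Phi> ` (lcosets H)"
        using val by (force simp: LCOSETS_def)
    qed
  qed
  ultimately show "bij_betw \<Phi> (lcosets (stabilizer G \<phi> x)) E"
    by (simp add: bij_betw_def H_def)
qed

section \<open>Quotients of compact spaces\<close>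

lemma topspace_quotient_topology: "topspace (quotient_topology X p) = p ` topspace X"
proof -
  have "{x \<in> topspace X. p x \<in> p ` topspace X} = topspace X" by auto
  then have "openin (quotient_topology X p) (p ` topspace X)"
    by (simp add: openin_quotient_topology)
  then show ?thesis
    by (metis openin_quotient_topology openin_subset openin_topspace subset_antisym)
qed

text \<open>A continuous surjection from a compact space to a Hausdorff space is a quotient map, so
  \<open>Y\<close> carries the quotient topology of \<open>q\<close>. Since \<open>q\<close> factors
  through \<open>p\<close> by the injective \<open>\<Phi>\<close>, the two quotients
  correspond.\<close>

lemma homeomorphic_map_quotient_topology:
  assumes "compact_space X" "Hausdorff_space Y" "continuous_map X Y q" "q ` topspace X = topspace Y"
    and \<Phi>: "\<And>x. x \<in> topspace X \<Longrightarrow> \<Phi> (p x) = q x" and inj: "inj_on \<Phi> (p ` topspace X)"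
  shows "homeomorphic_map (quotient_topology X p) Y \<Phi>"
proof -
  have "quotient_map X Y q"
    using assms by (intro continuous_imp_quotient_map)
  moreover have "{x \<in> topspace X. p x \<in> {c \<in> p ` topspace X. \<Phi> c \<in> U}} = {x \<in> topspace X. q x \<in> U}" for U
    using \<Phi> by (auto simp flip: \<Phi>)
  moreover have "\<Phi> ` p ` topspace X = q ` topspace X"
    using \<Phi> by (simp add: image_image)
  ultimately have "quotient_map (quotient_topology X p) Y \<Phi>"
    by (simp add: quotient_map_def topspace_quotient_topology openin_quotient_topology subset_iff)
  then show ?thesis
    using inj by (simp add: homeomorphic_map_def topspace_quotient_topology)
qed

section \<open>The action on pairs of a subspace and a complex structure\<close>

lemma G2_simps [simp]: "mult G2 = (\<circ>)" "one G2 = id"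
  by (simp_all add: G2_def)

lemma inv_into_in_G2:
  assumes f: "f \<in> carrier G2"
  shows "inv_into UNIV f \<in> carrier G2"
proof -
  note bij = G2D(2)[OF f]
  have f': "f (inv_into UNIV f x) = x" for x
    using bij by (simp add: bij_is_surj surj_f_inv_f)
  have "inv_into UNIV f (omult x y) = omult (inv_into UNIV f x) (inv_into UNIV f y)" for x y
    by (rule inv_f_eq[OF bij_is_inj[OF bij]]) (simp add: G2D(3)[OF f] f')
  moreover have "inv_into UNIV f o1 = o1"
    by (rule inv_f_eq[OF bij_is_inj[OF bij]]) (simp add: G2D(4)[OF f])
  moreover have "linear (inv_into UNIV f)"
    using G2D(1)[OF f] bij_is_inj[OF bij] bij
    by (intro linearI inv_f_eq) (simp_all add: linear_add linear_cmul f')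
  ultimately show ?thesis
    by (simp add: G2_iff)
qed

lemma group_G2: "group G2"
proof (rule groupI)
  show "\<one>\<^bsub>G2\<^esub> \<in> carrier G2"
    by (simp add: G2_iff linear_id[unfolded id_def] id_def linear_ident)
  fix f assume f: "f \<in> carrier G2"
  then have "inv_into UNIV f \<circ> f = id"
    using G2D(2) bij_is_inj by (intro inv_o_cancel) blast
  then show "\<exists>g\<in>carrier G2. g \<otimes>\<^bsub>G2\<^esub> f = \<one>\<^bsub>G2\<^esub>"
    using inv_into_in_G2[OF f] by (intro bexI[of _ "inv_into UNIV f"]) simp_all
qed (simp_all add: G2_iff linear_compose comp_assoc)

text \<open>On imaginary \<open>W\<close> the cross product differs from \<open>omult\<close> by a
  multiple of \<open>o1\<close>. \<open>Omega\<close> does not see it, and \<open>J\<close>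
  preserves it because the multiple is the inner product. The determinant comes from
  \<open>det4_on_complex_structure\<close>.\<close>

lemma M4_iff:
  "(W, J) \<in> M4 \<longleftrightarrow> subspace W \<and> dim W = 4 \<and> (\<forall>x\<in>W. x \<bullet> o1 = 0) \<and>
     (\<forall>x\<in>W. \<forall>y\<in>W. \<forall>z\<in>W. x \<bullet> omult y z = 0) \<and> J \<in> End_on W \<and>
     (\<forall>x\<in>W. \<forall>y\<in>W. J x \<bullet> J y = x \<bullet> y) \<and> (\<forall>x\<in>W. J (J x) = - x) \<and>
     (\<forall>x\<in>W. \<forall>y\<in>W. omult (J x) (J y) = omult x y)"
  (is "_ \<longleftrightarrow> ?R")
proof -
  have sub: "W \<subseteq> Im_oct \<longleftrightarrow> (\<forall>x\<in>W. x \<bullet> o1 = 0)"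
    by (auto simp: Im_oct_def opol_inner inner_commute)
  have Om: "Omega x y z = x \<bullet> omult y z" if "\<forall>x\<in>W. x \<bullet> o1 = 0" "x \<in> W" for x y z
    using that by (simp add: Omega_def ocross_def opol_inner inner_diff_right)
  have cross: "ocross x y = omult x y + (x \<bullet> y) *\<^sub>R o1" if "\<forall>x\<in>W. x \<bullet> o1 = 0" "y \<in> W" for x y
    using that by (simp add: ocross_def opol_inner inner_omult_o1 ocnj_imaginary)
  have JW: "J x \<in> W" if "J \<in> End_on W" "x \<in> W" for x
    using that by (auto simp: End_on_def)
  have "((W, J) \<in> M4 \<longleftrightarrow> ?R)" if im: "\<forall>x\<in>W. x \<bullet> o1 = 0"
  proof -
    have det: "det4_on W J = 1"
      if "subspace W \<and> dim W = 4 \<and> J \<in> End_on W \<and> (\<forall>x\<in>W. J (J x) = - x)"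
      using that det4_on_complex_structure by blast
    have 1: "(\<forall>x\<in>W. \<forall>y\<in>W. \<forall>z\<in>W. Omega x y z = 0) \<longleftrightarrow>
        (\<forall>x\<in>W. \<forall>y\<in>W. \<forall>z\<in>W. x \<bullet> omult y z = 0)"
      using im by (simp add: Om cong: ball_cong)
    have 2: "(\<forall>x\<in>W. \<forall>y\<in>W. ocross (J x) (J y) = ocross x y) \<longleftrightarrow>
        (\<forall>x\<in>W. \<forall>y\<in>W. omult (J x) (J y) = omult x y)"
  (is "_ \<longleftrightarrow> ?R")
      if "J \<in> End_on W \<and> (\<forall>x\<in>W. \<forall>y\<in>W. J x \<bullet> J y = x \<bullet> y)"
      using that im JW by (simp add: cross cong: ball_cong)
    show ?thesis
      unfolding M4_def M1'_def SO4_on_def mem_Collect_eq prod.case sub opol_inner 1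
      using det 2 im by argo
  qed
  moreover have "(W, J) \<notin> M4 \<and> \<not> ?R" if "\<not> (\<forall>x\<in>W. x \<bullet> o1 = 0)"
    unfolding M4_def M1'_def mem_Collect_eq prod.case sub using that by simp
  ultimately show ?thesis
    by argo
qed

lemma End_on_mem: "J \<in> End_on W \<Longrightarrow> x \<in> W \<Longrightarrow> J x \<in> W"
  by (auto simp: End_on_def)

lemma End_on_extensional: "J \<in> End_on W \<Longrightarrow> J \<in> extensional W"
  by (simp add: End_on_def PiE_def)

lemma M4_act_eq:
  assumes "(W, J) \<in> M4"
  shows "M4_act f (W, J) = (f ` W, restrict (f \<circ> J \<circ> inv_into UNIV f) (f ` W))"
  using assms by (simp add: M4_act_def)

text \<open>It suffices that \<open>f\<close> intertwines \<open>J\<close> and \<open>K\<close> on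
  \<open>W\<close>; extensionality fixes \<open>K\<close> outside \<open>V\<close>. This keeps the
  inverse of \<open>f\<close> out of later arguments.\<close>

lemma M4_act_eqI:
  assumes m: "(W, J) \<in> M4" and f: "f \<in> carrier G2" and V: "V = f ` W" and "K \<in> extensional V"
    and K: "\<And>x. x \<in> W \<Longrightarrow> K (f x) = f (J x)"
  shows "M4_act f (W, J) = (V, K)"
proof -
  have "restrict (f \<circ> J \<circ> inv_into UNIV f) (f ` W) = K"
    using assms G2D(2)[OF f] by (intro extensionalityI[of _ V]) (auto simp: bij_is_inj)
  then show ?thesis
    using V by (simp add: M4_act_eq[OF m])
qed

lemma M4_act_snd:
  assumes m: "(W, J) \<in> M4" and f: "f \<in> carrier G2" and x: "x \<in> W"
  shows "snd (M4_act f (W, J)) (f x) = f (J x)"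
  using x G2D(2)[OF f] by (simp add: M4_act_eq[OF m] bij_is_inj)

lemma M4_act_closed:
  assumes m: "(W, J) \<in> M4" and f: "f \<in> carrier G2"
  shows "M4_act f (W, J) \<in> M4"
proof -
  define K where "K = restrict (f \<circ> J \<circ> inv_into UNIV f) (f ` W)"
  note lin = G2D(1)[OF f] and bij = G2D(2)[OF f]
  \<comment> \<open>Conditions on \<open>K\<close> are checked at points \<open>f x\<close>, where
    they become the conditions on \<open>J\<close>.\<close>
  have K: "K (f x) = f (J x)" if "x \<in> W" for x
    using that bij by (simp add: K_def bij_is_inj)
  have J: "J \<in> End_on W" and W: "subspace W" and JW: "\<And>x. x \<in> W \<Longrightarrow> J x \<in> W"
    using m by (auto simp: M4_iff intro: End_on_mem)
  have "dim (f ` W) = dim W"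
    using lin bij by (intro dim_image_eq) (auto simp: bij_def inj_on_def)
  moreover have "f x \<bullet> o1 = x \<bullet> o1" for x
    using G2_inner[OF f, of x o1] G2D(4)[OF f] by simp
  moreover have "K \<in> End_on (f ` W)"
    unfolding End_on_def
  proof (intro CollectI conjI ballI allI PiE_I)
    fix y z c assume "y \<in> f ` W"
    then obtain a where a: "a \<in> W" "y = f a" by auto
    then show "K y \<in> f ` W"
      using K JW by simp
    have "K (c *\<^sub>R f a) = c *\<^sub>R K (f a)"
      using a J K[of a] K[of "c *\<^sub>R a"] subspace_mul[OF W, of a c]
      by (simp add: End_on_def linear_cmul[OF lin])
    then show "K (c *\<^sub>R y) = c *\<^sub>R K y"
      using a by simp
    assume "z \<in> f ` W"
    then obtain b where b: "b \<in> W" "z = f b" by auto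
    have "K (f a + f b) = K (f a) + K (f b)"
      using a b J K[of a] K[of b] K[of "a + b"] subspace_add[OF W, of a b]
      by (simp add: End_on_def linear_add[OF lin])
    then show "K (y + z) = K y + K z"
      using a b by simp
  qed (simp add: K_def)
  ultimately have "(f ` W, K) \<in> M4"
    using m unfolding M4_iff
    by (simp add: linear_subspace_image[OF lin] K JW G2_inner[OF f] linear_neg[OF lin]
        flip: G2D(3)[OF f])
  then show ?thesis
    by (simp add: M4_act_eq[OF m] K_def)
qed

lemma M4_act_id: "m \<in> M4 \<Longrightarrow> M4_act id m = m"
proof (cases m)
  case (Pair W J)
  assume m: "m \<in> M4"
  then have "J \<in> extensional W"
    using Pair by (auto simp: M4_iff intro: End_on_extensional)
  then show ?thesis
    using m Pair group.is_monoid[OF group_G2] monoid.one_closed[of G2]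
    by (auto intro!: M4_act_eqI)
qed

lemma M4_act_comp:
  assumes m: "m \<in> M4" and f: "f \<in> carrier G2" and g: "g \<in> carrier G2"
  shows "M4_act (f \<circ> g) m = M4_act f (M4_act g m)"
proof (cases m)
  case (Pair W J)
  then have WJ: "(W, J) \<in> M4" using m by simp
  obtain V K where VK: "M4_act g (W, J) = (V, K)" by fastforce
  obtain U L where UL: "M4_act f (V, K) = (U, L)" by fastforce
  have VK': "(V, K) \<in> M4"
    using M4_act_closed[OF WJ g] VK by simp
  then have UL': "(U, L) \<in> M4"
    using M4_act_closed[OF _ f] UL by metis
  have V: "V = g ` W" and U: "U = f ` V"
    using VK UL by (simp_all add: M4_act_eq WJ VK')
  have "f \<circ> g \<in> carrier G2"
    using monoid.m_closed[OF group.is_monoid[OF group_G2] f g] by simp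
  then have "M4_act (f \<circ> g) (W, J) = (U, L)"
  proof (rule M4_act_eqI[OF WJ])
    show "U = (f \<circ> g) ` W" using U V by (simp add: image_comp)
    show "L \<in> extensional U" using UL' by (auto simp: M4_iff intro: End_on_extensional)
    fix x assume "x \<in> W"
    then show "L ((f \<circ> g) x) = (f \<circ> g) (J x)"
      using M4_act_snd[OF WJ g, of x] M4_act_snd[OF VK' f, of "g x"] imageI[of x W g, folded V]
      unfolding VK UL by simp
  qed
  then show ?thesis
    by (simp add: Pair VK UL)
qed

lemma group_action_M4: "group_action G2 M4 M4_act"
proof -
  have inv: "inv_into UNIV f \<circ> f = id" "f \<circ> inv_into UNIV f = id" if "f \<in> carrier G2" for f
    using G2D(2)[OF that] by (simp_all add: bij_def surj_iff inj_iff)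
  have closed: "M4_act f m \<in> M4" if "f \<in> carrier G2" "m \<in> M4" for f m
    using that M4_act_closed by (cases m) simp
  have "bij_betw (M4_act f) M4 M4" if f: "f \<in> carrier G2" for f
    using f M4_act_comp[OF _ f inv_into_in_G2[OF f]] M4_act_comp[OF _ inv_into_in_G2[OF f] f]
      closed[OF f] closed[OF inv_into_in_G2[OF f]]
    by (intro bij_betw_byWitness[where f' = "M4_act (inv_into UNIV f)"])
      (auto simp: inv[OF f] M4_act_id)
  \<comment> \<open>Elements of \<open>Bij M4\<close> must be extensional, which the restriction in
    \<open>M4_act\<close> provides.\<close>
  moreover have ext: "M4_act f \<in> extensional M4" for f
    by (simp add: M4_act_def)
  ultimately have Bij: "M4_act f \<in> Bij M4" if "f \<in> carrier G2" for f
    using that by (simp add: Bij_def)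
  show ?thesis
    unfolding group_action_def group_hom_def group_hom_axioms_def
  proof (intro conjI homI group_G2 group_BijGroup)
    fix f g assume f: "f \<in> carrier G2" and g: "g \<in> carrier G2"
    show "M4_act (f \<otimes>\<^bsub>G2\<^esub> g) = M4_act f \<otimes>\<^bsub>BijGroup M4\<^esub> M4_act g"
      using Bij[OF f] Bij[OF g] M4_act_comp[OF _ f g]
      by (intro extensionalityI[of _ M4]) (simp_all add: BijGroup_def compose_def ext)
  qed (simp add: Bij BijGroup_def)
qed

section \<open>The base point\<close>

lemma mem_Hl: "x \<in> Hl \<longleftrightarrow> fst x = 0"
  by (cases x) (auto simp: Hl_def)

lemma subspace_Hl: "subspace Hl"
  by (auto simp: subspace_def mem_Hl)

lemma dim_Hl: "dim Hl = 4"
proof -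
  have "Hl = (\<lambda>q. (0, q)) ` (UNIV :: quat set)"
    by (auto simp: Hl_def)
  moreover have "linear (\<lambda>q :: quat. (0 :: quat, q))"
    by (rule linearI) simp_all
  ultimately show ?thesis
    using dim_image_eq[of "\<lambda>q :: quat. (0 :: quat, q)" UNIV] by (simp add: inj_on_def)
qed

lemma J0_apply [simp]: "J0 (0, q) = (0, qmult qi q)"
  by (simp add: J0_def mem_Hl)

lemma qi_qmult_linear:
  "qmult qi (p + q) = qmult qi p + qmult qi q" "qmult qi (c *\<^sub>R q) = c *\<^sub>R qmult qi q"
  by (cases p rule: prod_cases4, cases q rule: prod_cases4, simp add: qi_def)+

lemma qmult_qi_qi [simp]: "qmult qi (qmult qi q) = - q"
  by (cases q rule: prod_cases4) (simp add: qi_def)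

lemma qcnj_qi_qmult: "qmult (qcnj (qmult qi p)) (qmult qi q) = qmult (qcnj p) q"
  by (cases p rule: prod_cases4, cases q rule: prod_cases4) (simp add: qi_def algebra_simps)

lemma inner_qi_qmult: "qmult qi p \<bullet> qmult qi q = p \<bullet> q"
  by (cases p rule: prod_cases4, cases q rule: prod_cases4) (simp add: qi_def algebra_simps)

text \<open>Products of two elements of H l lie in H, which is orthogonal to H l; in conj(i p) (i q)
  the factors i cancel.\<close>

lemma base_in_M4: "(Hl, J0) \<in> M4"
proof -
  have "J0 \<in> End_on Hl"
    unfolding End_on_def
    by (intro CollectI conjI ballI allI PiE_I) (simp_all add: mem_Hl J0_def qi_qmult_linear)
  then show ?thesis
    unfolding M4_iff using subspace_Hl dim_Hl
    by (auto simp: Hl_def o1_def inner_qi_qmult qcnj_qi_qmult)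
qed

section \<open>Transitivity\<close>

lemma transitive_from_base:
  assumes m: "(W, J) \<in> M4"
  obtains f where "f \<in> carrier G2" "M4_act f (Hl, J0) = (W, J)"
proof -
  have W: "subspace W" "dim W = 4" and im: "\<And>x. x \<in> W \<Longrightarrow> x \<bullet> o1 = 0"
    and Om: "\<And>x y z. x \<in> W \<Longrightarrow> y \<in> W \<Longrightarrow> z \<in> W \<Longrightarrow> x \<bullet> omult y z = 0"
    and J: "J \<in> End_on W" and Jinn: "\<And>x y. x \<in> W \<Longrightarrow> y \<in> W \<Longrightarrow> J x \<bullet> J y = x \<bullet> y"
    and JJ: "\<And>x. x \<in> W \<Longrightarrow> J (J x) = - x"
    and Jmult: "\<And>x y. x \<in> W \<Longrightarrow> y \<in> W \<Longrightarrow> omult (J x) (J y) = omult x y"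
    using m by (simp_all add: M4_iff)
  have JW: "J x \<in> W" if "x \<in> W" for x using J that by (rule End_on_mem)
  \<comment> \<open>Fewer than four vectors cannot span \<open>W\<close>. Used for the empty set and
    for \<open>{x, J x}\<close>.\<close>
  have unit: "\<exists>y\<in>W. y \<bullet> y = 1 \<and> (\<forall>z\<in>S. y \<bullet> z = 0)" if S: "S \<subseteq> W" "finite S" "card S < 4" for S
  proof -
    have "dim S < dim W"
      using dim_le_card'[OF S(2)] S(3) W(2) by simp
    then have "span S \<subset> span W"
      using S by (metis dim_span order_less_irrefl psubsetI span_mono)
    then obtain y where y: "y \<noteq> 0" "y \<in> span W" "\<And>z. z \<in> span S \<Longrightarrow> orthogonal y z"
      using orthogonal_to_subspace_exists_gen by blast
    then have "(y /\<^sub>R norm y) \<in> W"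
      using W span_eq_iff subspace_mul by metis
    moreover have "(y /\<^sub>R norm y) \<bullet> (y /\<^sub>R norm y) = 1"
      using y by (simp add: dot_square_norm power2_eq_square)
    moreover have "\<forall>z\<in>S. (y /\<^sub>R norm y) \<bullet> z = 0"
      using y(3)[OF span_base] by (simp add: orthogonal_def)
    ultimately show ?thesis by blast
  qed
  obtain x where x: "x \<in> W" "x \<bullet> x = 1"
    using unit[of "{}"] by auto
  obtain y where y: "y \<in> W" "y \<bullet> y = 1" "y \<bullet> x = 0" "y \<bullet> J x = 0"
  proof -
    have "\<exists>y\<in>W. y \<bullet> y = 1 \<and> (\<forall>z\<in>{x, J x}. y \<bullet> z = 0)"
      using x JW by (intro unit) (simp_all add: card_insert_if)
    then show thesis using that by fast
  qed
  \<comment> \<open>An orthogonal map with square -1 is skew.\<close>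
  have xJ: "J x \<bullet> x = 0"
    using Jinn[of x "J x"] x JW JJ by (simp add: inner_commute)
  \<comment> \<open>Chosen to solve u x = J x and v x = y: right multiplication by the imaginary
    unit \<open>x\<close> squares to -1.\<close>
  define u where "u = - omult (J x) x"
  define v where "v = - omult y x"
  have ux: "omult u x = J x" and vx: "omult v x = y"
    using x im by (simp_all add: u_def v_def omult_bilinear_simps omult_imaginary_right)
  have u: "u \<bullet> o1 = 0" "u \<bullet> u = 1"
    using x im JW xJ Jinn
    by (simp_all add: u_def inner_omult_o1 ocnj_imaginary inner_omult_same_right)
  have v: "v \<bullet> o1 = 0" "v \<bullet> v = 1"
    using x y im by (simp_all add: v_def inner_omult_o1 ocnj_imaginary inner_omult_same_right)
  have uv: "u \<bullet> v = 0"
    using x y by (simp add: u_def v_def inner_omult_same_right inner_commute)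
  have xu: "x \<bullet> u = 0" and xv: "x \<bullet> v = 0"
    using x y im JW by (simp_all add: u_def v_def Om)
  \<comment> \<open>Moving \<open>u\<close> across the inner product leaves \<open>J x\<close>
    paired with a product of two elements of \<open>W\<close>, which \<open>Om\<close>
    annihilates.\<close>
  have xuv: "x \<bullet> omult u v = 0"
  proof -
    have "x \<bullet> omult u v = - (omult u x \<bullet> v)"
      using u inner_omult_left[of u v x]
      by (simp add: inner_omult_left[of u x v] inner_commute ocnj_imaginary omult_bilinear_simps)
    also have "\<dots> = 0"
      using x y JW by (simp add: ux v_def Om)
    finally show ?thesis .
  qed
  \<comment> \<open>From (J x)(J y) = x y = v, left multiplication by \<open>J x\<close> gives (J x)
    v = - J y. By the second doubling rule (J x) v = (u x) v is also - (u v) x.\<close>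
  have "omult (omult u v) x = J y"
  proof -
    have vu: "omult v u = - omult u v"
      using u v uv by (intro omult_imaginary_anticommute)
    have "omult x y = v"
      using x y im by (simp add: v_def omult_imaginary_anticommute)
    then have "omult (J x) v = - J y"
      using x y im JW Jmult[of x y] Jinn[of x x] omult_imaginary_left[of "J x" "J y"]
      by simp
    moreover have "omult (omult u x) v = omult (omult u (ocnj v)) x"
      using x im xu xv xuv v vu
      by (intro cayley_dickson_2) (simp_all add: ocnj_imaginary omult_bilinear_simps)
    ultimately show ?thesis
      using v by (simp add: ux ocnj_imaginary omult_bilinear_simps)
  qed
  define f where "f = (\<lambda>(p, q). qmap u v p + omult (qmap u v q) x)"
  have f: "f \<in> carrier G2"
    unfolding f_def using u v uv x im xu xv xuv by (intro triple_automorphism)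
  have fHl: "f (0, (a, b, c, d)) = a *\<^sub>R x + b *\<^sub>R J x + c *\<^sub>R y + d *\<^sub>R J y" for a b c d
  proof -
    have "qmap u v (a, b, c, d) = a *\<^sub>R o1 + b *\<^sub>R u + c *\<^sub>R v + d *\<^sub>R omult u v"
      by (simp add: qmap_def)
    then show ?thesis
      using \<open>omult (omult u v) x = J y\<close> linear_0[OF linear_qmap]
      by (simp add: f_def omult_bilinear_simps ux vx)
  qed
  have sub: "f ` Hl \<subseteq> W"
  proof
    fix z assume "z \<in> f ` Hl"
    then obtain a b c d where "z = f (0, (a, b, c, d))"
      by (auto simp: Hl_def)
    then show "z \<in> W"
      using x y JW W(1) by (simp add: fHl subspace_add subspace_mul)
  qed
  have "dim (f ` Hl) = 4"
    using G2D(1,2)[OF f] dim_Hl by (subst dim_image_eq) (auto simp: bij_def inj_on_def)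
  then have fW: "f ` Hl = W"
    using sub W linear_subspace_image[OF G2D(1)[OF f] subspace_Hl] by (intro subspace_dim_equal) auto
  have "M4_act f (Hl, J0) = (W, J)"
  proof (rule M4_act_eqI[OF base_in_M4 f fW[symmetric] End_on_extensional[OF J]])
    fix z assume "z \<in> Hl"
    then obtain a b c d where z: "z = (0, (a, b, c, d))"
      by (auto simp: Hl_def)
    have add: "J (p + q) = J p + J q" if "p \<in> W" "q \<in> W" for p q
      using J that by (simp add: End_on_def)
    have scale: "J (r *\<^sub>R p) = r *\<^sub>R J p" if "p \<in> W" for r p
      using J that by (simp add: End_on_def)
    show "J (f z) = f (J0 z)"
      using x y JW W(1)
      by (simp add: z fHl qi_def add scale JJ subspace_add subspace_mul)
  qed
  with f show ?thesis ..
qed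

lemma transitive_action_M4: "transitive_action G2 M4 M4_act"
proof -
  interpret group_action G2 M4 M4_act
    by (rule group_action_M4)
  interpret group G2
    by (rule group_G2)
  show ?thesis
  proof
    fix x y assume x: "x \<in> M4" and y: "y \<in> M4"
    obtain f where f: "f \<in> carrier G2" "M4_act f (Hl, J0) = x"
      using x transitive_from_base by (metis surj_pair)
    obtain g where g: "g \<in> carrier G2" "M4_act g (Hl, J0) = y"
      using y transitive_from_base by (metis surj_pair)
    have "M4_act (inv\<^bsub>G2\<^esub> f) x = (Hl, J0)"
      using f base_in_M4 by (intro orbit_sym_aux)
    then have "M4_act (g \<otimes>\<^bsub>G2\<^esub> inv\<^bsub>G2\<^esub> f) x = y"
      using f g x composition_rule[OF x g(1) inv_closed[OF f(1)]] by (simp del: G2_simps)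
    then show "\<exists>g\<in>carrier G2. M4_act g x = y"
      using f(1) g(1) m_closed by blast
  qed
qed

section \<open>The isotropy group\<close>

lemma omult_Hl_q1: "omult (0, p) (0, q1) = (- p, 0)"
  by (cases p rule: prod_cases4) (simp add: q1_def)

text \<open>H l generates the octonions: by \<open>omult_Hl_q1\<close> every quaternion is a product
  of two of its elements.\<close>

lemma G2_eqI_on_Hl:
  assumes f: "f \<in> carrier G2" and g: "g \<in> carrier G2" and eq: "\<And>q. f (0, q) = g (0, q)"
  shows "f = g"
proof
  fix x :: oct
  obtain p q where x: "x = (p, q)" by fastforce
  have "f (- p, 0) = g (- p, 0)" for p
    using G2D(3)[OF f, of "(0, p)" "(0, q1)"] G2D(3)[OF g, of "(0, p)" "(0, q1)"]
    unfolding omult_Hl_q1 eq by simp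
  from this[of "- p"] have "f (p, 0) + f (0, q) = g (p, 0) + g (0, q)"
    by (simp add: eq)
  then show "f x = g x"
    unfolding x linear_add[OF G2D(1)[OF f], symmetric] linear_add[OF G2D(1)[OF g], symmetric] by simp
qed

lemma tau_in_G2: "tau \<in> carrier G2"
  unfolding G2_iff
proof (intro conjI allI)
  show "linear tau"
    by (rule linearI) (simp_all add: tau_def qi_qmult_linear)
  show "tau o1 = o1"
    by (simp add: tau_def o1_def)
  fix x y :: oct
  show "tau (omult x y) = omult (tau x) (tau y)"
    by (cases x rule: prod.exhaust, cases y rule: prod.exhaust)
      (auto simp: tau_def qi_def algebra_simps)
qed

text \<open>H l is the eigenspace of \<open>tau \<circ> tau\<close> for -1, so a linear map that
  commutes with \<open>tau\<close> preserves it and commutes there with left multiplication by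
  i.\<close>

lemma H4_on_Hl:
  assumes f: "f \<in> H4"
  shows "f (0, q) = (0, snd (f (0, q)))" "snd (f (0, qmult qi q)) = qmult qi (snd (f (0, q)))"
proof -
  have lin: "linear f" and comm: "f (tau x) = tau (f x)" for x
    using f G2D(1) by (auto simp: H4_def fun_eq_iff)
  have "f (tau (tau (0, q))) = - f (0, q)"
    using linear_neg[OF lin, of "(0, q)"] by (simp add: tau_def)
  then have "fst (f (0, q)) = - fst (f (0, q))"
    unfolding comm by (metis tau_def fst_conv fst_uminus)
  then have "2 *\<^sub>R fst (f (0, q)) = 0"
    by (metis scaleR_2 neg_eq_iff_add_eq_0)
  then have "fst (f (0, q)) = 0"
    by simp
  then show "f (0, q) = (0, snd (f (0, q)))"
    by (metis prod.collapse)
  show "snd (f (0, qmult qi q)) = qmult qi (snd (f (0, q)))"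
    using comm[of "(0, q)"] by (simp add: tau_def)
qed

text \<open>\<open>tau\<close> extends \<open>J0\<close>. If \<open>f\<close> fixes the base point,
  the automorphisms \<open>f \<circ> tau\<close> and \<open>tau \<circ> f\<close> agree on H l,
  hence everywhere; the converse restricts the commutation to H l.\<close>

lemma stabilizer_base: "stabilizer G2 M4_act (Hl, J0) = H4"
proof (intro equalityI subsetI)
  fix f assume "f \<in> stabilizer G2 M4_act (Hl, J0)"
  then have f: "f \<in> carrier G2" and st: "M4_act f (Hl, J0) = (Hl, J0)"
    by (simp_all add: stabilizer_def)
  have "f ` Hl = Hl"
    using st by (simp add: M4_act_eq[OF base_in_M4])
  then have *: "fst (f (0, q)) = 0" for q
    using mem_Hl by (metis fst_conv imageI)
  have "f \<circ> tau = tau \<circ> f"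
  proof (rule G2_eqI_on_Hl)
    show "f \<circ> tau \<in> carrier G2" "tau \<circ> f \<in> carrier G2"
      using monoid.m_closed[OF group.is_monoid[OF group_G2]] f tau_in_G2 by force+
    fix q
    have "J0 (f (0, q)) = f (J0 (0, q))"
      using M4_act_snd[OF base_in_M4 f, of "(0, q)"] by (simp add: st mem_Hl)
    moreover have "J0 (f (0, q)) = tau (f (0, q))"
      using * by (simp add: J0_def mem_Hl tau_def)
    ultimately show "(f \<circ> tau) (0, q) = (tau \<circ> f) (0, q)"
      by (simp add: tau_def)
  qed
  with f show "f \<in> H4"
    by (simp add: H4_def)
next
  fix f assume H: "f \<in> H4"
  then have f: "f \<in> carrier G2"
    by (simp add: H4_def)
  have "f ` Hl \<subseteq> Hl"
    using H4_on_Hl(1)[OF H] by (force simp: Hl_def)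
  moreover have "dim (f ` Hl) = 4"
    using G2D(1,2)[OF f] dim_Hl by (subst dim_image_eq) (auto simp: bij_def inj_on_def)
  ultimately have fHl: "f ` Hl = Hl"
    using linear_subspace_image[OF G2D(1)[OF f] subspace_Hl] subspace_Hl dim_Hl
    by (intro subspace_dim_equal) auto
  have "M4_act f (Hl, J0) = (Hl, J0)"
  proof (rule M4_act_eqI[OF base_in_M4 f fHl[symmetric]])
    fix x assume "x \<in> Hl"
    then obtain q where x: "x = (0, q)" by (auto simp: Hl_def)
    define r where "r = snd (f (0, q))"
    have "f (0, q) = (0, r)" "f (0, qmult qi q) = (0, qmult qi r)"
      using H4_on_Hl(1)[OF H, of q] H4_on_Hl(1)[OF H, of "qmult qi q"] H4_on_Hl(2)[OF H, of q]
      unfolding r_def by argo+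
    then show "J0 (f x) = f (J0 x)"
      by (simp add: x)
  qed (simp add: J0_def)
  with f show "f \<in> stabilizer G2 M4_act (Hl, J0)"
    by (simp add: stabilizer_def)
qed

section \<open>The isotropy group is the unitary group\<close>

text \<open>The quaternion z + w j has coordinates z and w, so left multiplication by i becomes
  multiplication by the imaginary unit.\<close>

definition cvec :: "quat \<Rightarrow> complex^2" where
  "cvec = (\<lambda>(a, b, c, d). vector [Complex a b, Complex c d])"

definition quat_of :: "complex^2 \<Rightarrow> quat" where
  "quat_of z = (Re (z $ 1), Im (z $ 1), Re (z $ 2), Im (z $ 2))"

lemma cvec_nth: "cvec (a, b, c, d) $ 1 = Complex a b" "cvec (a, b, c, d) $ 2 = Complex c d"
  by (simp_all add: cvec_def)

lemma cvec_quat_of [simp]: "cvec (quat_of z) = z"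
  by (simp add: quat_of_def vec_eq_iff forall_2 cvec_nth)

lemma quat_of_cvec [simp]: "quat_of (cvec q) = q"
  by (cases q rule: prod_cases4) (simp add: quat_of_def cvec_nth)

lemma cvec_add: "cvec (p + q) = cvec p + cvec q"
  by (cases p rule: prod_cases4, cases q rule: prod_cases4)
    (simp add: vec_eq_iff forall_2 cvec_nth complex_eq_iff)

lemma cvec_scale: "cvec (a *\<^sub>R q + b *\<^sub>R qmult qi q) = Complex a b *s cvec q"
  by (cases q rule: prod_cases4) (simp add: vec_eq_iff forall_2 cvec_nth complex_eq_iff qi_def)

lemma linear_cvec: "linear cvec"
  using cvec_scale[of _ _ 0]
  by (intro linearI cvec_add) (simp add: vec_eq_iff complex_eq_iff)

definition herm :: "complex^2 \<Rightarrow> complex^2 \<Rightarrow> complex" where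
  "herm z w = (\<Sum>k\<in>UNIV. cnj (z $ k) * w $ k)"

text \<open>Consequently a complex linear map that preserves the real inner product preserves
  \<open>herm\<close>.\<close>

lemma herm_cvec: "herm (cvec p) (cvec q) = Complex (p \<bullet> q) (qmult qi p \<bullet> q)"
  by (cases p rule: prod_cases4, cases q rule: prod_cases4)
    (simp add: herm_def sum_2 cvec_nth complex_eq_iff qi_def)

definition H4_matrix :: "(oct \<Rightarrow> oct) \<Rightarrow> complex^2^2" where
  "H4_matrix f = matrix (\<lambda>z. cvec (snd (f (0, quat_of z))))"

text \<open>A complex multiple of q is a real combination of q and i q, so real linearity and
  commutation with i give the complex linearity that \<open>matrix_works\<close> asks for.\<close>

lemma H4_matrix_works:
  assumes f: "f \<in> H4"
  shows "H4_matrix f *v cvec q = cvec (snd (f (0, q)))"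
proof -
  have lin: "linear (\<lambda>q. snd (f (0, q)))"
  proof -
    have "linear f" using f by (auto simp: H4_def G2D(1))
    moreover have "linear (\<lambda>q :: quat. (0 :: quat, q))" by (rule linearI) simp_all
    ultimately show ?thesis
      using linear_compose[OF linear_compose linear_snd] by (simp add: o_def)
  qed
  have "Vector_Spaces.linear (*s) (*s) (\<lambda>z. cvec (snd (f (0, quat_of z))))" (is "Vector_Spaces.linear _ _ ?L")
  proof (unfold_locales)
    fix z w :: "complex^2" and c :: complex
    have "quat_of (z + w) = quat_of z + quat_of w"
      by (metis cvec_add cvec_quat_of quat_of_cvec)
    then show "?L (z + w) = ?L z + ?L w"
      by (simp add: linear_add[OF lin] cvec_add)
    have "quat_of (c *s z) = Re c *\<^sub>R quat_of z + Im c *\<^sub>R qmult qi (quat_of z)"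
      using cvec_scale[of "Re c" "quat_of z" "Im c"] by (metis complex_surj cvec_quat_of quat_of_cvec)
    then show "?L (c *s z) = c *s ?L z"
      by (simp add: linear_add[OF lin] linear_cmul[OF lin] H4_on_Hl(2)[OF f] cvec_scale)
  qed
  then show ?thesis
    using matrix_works[of ?L "cvec q"] by (simp add: H4_matrix_def)
qed

text \<open>\<open>cadjoint A ** A\<close> is the Gram matrix of the columns of
  \<open>A\<close>.\<close>

lemma cadjoint_matrix_entry: "(cadjoint A ** A) $ r $ s = herm (A *v axis r 1) (A *v axis s 1)"
proof -
  have "(A *v axis s 1) $ k = A $ k $ s" for k s
    by (simp add: matrix_vector_mult_def axis_def if_distrib cong: if_cong)
  then show ?thesis
    by (simp add: matrix_matrix_mult_def cadjoint_def herm_def)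
qed

lemma mem_U2: "A \<in> carrier U2 \<longleftrightarrow> cadjoint A ** A = mat 1"
  using matrix_left_right_inverse[of A "cadjoint A"] by (auto simp: U2_def)

lemma H4_matrix_in_U2:
  assumes f: "f \<in> H4"
  shows "H4_matrix f \<in> carrier U2"
proof -
  have "f \<in> carrier G2"
    using f by (simp add: H4_def)
  have inn: "snd (f (0, p)) \<bullet> snd (f (0, q)) = p \<bullet> q" for p q
  proof -
    have "snd (f (0, p)) \<bullet> snd (f (0, q)) = (0 :: quat, snd (f (0, p))) \<bullet> (0, snd (f (0, q)))"
      unfolding inner_Pair by simp
    also have "\<dots> = (0 :: quat, p) \<bullet> (0, q)"
      unfolding H4_on_Hl(1)[OF f, symmetric] by (rule G2_inner[OF \<open>f \<in> carrier G2\<close>])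
    finally show ?thesis by simp
  qed
  have "herm (H4_matrix f *v cvec p) (H4_matrix f *v cvec q) = herm (cvec p) (cvec q)" for p q
    by (simp add: H4_matrix_works[OF f] herm_cvec inn flip: H4_on_Hl(2)[OF f])
  from this[of "quat_of _" "quat_of _"]
  have "herm (H4_matrix f *v z) (H4_matrix f *v w) = herm z w" for z w
    by simp
  then show ?thesis
    by (simp add: mem_U2 vec_eq_iff cadjoint_matrix_entry)
      (simp add: herm_def axis_def mat_def sum_2 forall_2)
qed

lemma H4_matrix_comp:
  assumes f: "f \<in> H4" and g: "g \<in> H4" and fg: "f \<circ> g \<in> H4"
  shows "H4_matrix (f \<circ> g) = H4_matrix f ** H4_matrix g"
proof -
  have "H4_matrix (f \<circ> g) *v cvec q = H4_matrix f *v (H4_matrix g *v cvec q)" for q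
    using H4_on_Hl(1)[OF g, of q] by (simp add: H4_matrix_works f g fg)
  from this[of "quat_of _"] show ?thesis
    by (simp add: matrix_eq matrix_vector_mul_assoc)
qed

lemma H4_matrix_inj: "inj_on H4_matrix H4"
proof (rule inj_onI)
  fix f g assume f: "f \<in> H4" and g: "g \<in> H4" and eq: "H4_matrix f = H4_matrix g"
  have "snd (f (0, q)) = snd (g (0, q))" for q
    using H4_matrix_works[OF f, of q] H4_matrix_works[OF g, of q] eq by (metis quat_of_cvec)
  then have "f (0, q) = g (0, q)" for q
    using H4_on_Hl(1)[OF f] H4_on_Hl(1)[OF g] by metis
  then show "f = g"
    using f g by (intro G2_eqI_on_Hl) (simp_all add: H4_def)
qed

text \<open>The automorphism \<open>z + w j \<mapsto> z + l w j\<close> of the quaternions, for complex \<open>z, w\<close> and a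
  unit complex number \<open>l\<close>.\<close>

definition qtwist :: "complex \<Rightarrow> quat \<Rightarrow> quat" where
  "qtwist l = (\<lambda>(a, b, c, d). (a, b, Re l * c - Im l * d, Re l * d + Im l * c))"

lemma qtwist_qmult:
  assumes "(Re l)\<^sup>2 + (Im l)\<^sup>2 = 1"
  shows "qtwist l (qmult p q) = qmult (qtwist l p) (qtwist l q)"
proof -
  have s: "Re l * Re l = 1 - Im l * Im l"
    using assms by (simp add: power2_eq_square)
  \<comment> \<open>The rewrite rule \<open>s\<close> once more, for right-nested products.\<close>
  have s': "Re l * (Re l * x) = x - Im l * (Im l * x)" for x
    using arg_cong[OF s, of "\<lambda>y. y * x"] by (simp add: algebra_simps)
  show ?thesis
    by (cases p rule: prod_cases4, cases q rule: prod_cases4) (simp add: qtwist_def algebra_simps s s')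
qed

lemma qtwist_qcnj: "qtwist l (qcnj p) = qcnj (qtwist l p)"
  by (cases p rule: prod_cases4) (simp add: qtwist_def)

lemma linear_qtwist: "linear (qtwist l)"
  by (rule linearI) (auto simp: qtwist_def algebra_simps)

lemma qmult_assoc: "qmult (qmult p q) r = qmult p (qmult q r)"
  by (cases p rule: prod_cases4, cases q rule: prod_cases4, cases r rule: prod_cases4)
    (simp add: algebra_simps)

lemma qcnj_qmult: "qcnj (qmult p q) = qmult (qcnj q) (qcnj p)"
  by (cases p rule: prod_cases4, cases q rule: prod_cases4) (simp add: algebra_simps)

lemma qcnj_qcnj: "qcnj (qcnj q) = q"
  by (cases q rule: prod_cases4) simp

lemma qmult_q1: "qmult q1 q = q" "qmult q q1 = q"
  by (cases q rule: prod_cases4; simp add: q1_def)+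

lemma qmult_qcnj_unit: "u \<bullet> u = 1 \<Longrightarrow> qmult u (qcnj u) = q1" "u \<bullet> u = 1 \<Longrightarrow> qmult (qcnj u) u = q1"
  by (cases u rule: prod_cases4; simp add: q1_def)+

lemma bilinear_qmult: "bilinear qmult"
  unfolding bilinear_def
  by (intro conjI allI linearI) (auto simp: algebra_simps)

text \<open>The map applies \<open>qtwist l\<close> to both components and then sends (p, q) to
  (conj(u) p u, q u). In products the inner factors u conj(u) cancel. It commutes with
  \<open>tau\<close> because the twist fixes i and \<open>u\<close> acts from the right.\<close>

lemma twist_in_H4:
  assumes u: "u \<bullet> u = 1" and l: "(Re l)\<^sup>2 + (Im l)\<^sup>2 = 1"
  shows "(\<lambda>(p, q). (qmult (qcnj u) (qmult (qtwist l p) u), qmult (qtwist l q) u)) \<in> H4" (is "?f \<in> H4")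
proof -
  note tw = linear_add[OF linear_qtwist] linear_cmul[OF linear_qtwist] linear_diff[OF linear_qtwist]
    qtwist_qmult[OF l] qtwist_qcnj
  note bil = bilinear_ladd[OF bilinear_qmult] bilinear_radd[OF bilinear_qmult]
    bilinear_lmul[OF bilinear_qmult] bilinear_rmul[OF bilinear_qmult]
    bilinear_lsub[OF bilinear_qmult] bilinear_rsub[OF bilinear_qmult]
  have uu: "qmult u (qmult (qcnj u) x) = x" for x
    using qmult_qcnj_unit(1)[OF u] by (simp add: qmult_q1 flip: qmult_assoc)
  have "?f \<in> carrier G2"
    unfolding G2_iff
  proof (intro conjI allI)
    show "linear ?f"
      by (rule linearI) (simp_all add: case_prod_beta tw bil)
    have "qtwist l q1 = q1" "qtwist l 0 = 0"
      by (simp_all add: qtwist_def q1_def zero_prod_def)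
    then show "?f o1 = o1"
      by (simp add: o1_def qmult_q1 qmult_qcnj_unit(2)[OF u])
    fix x y :: oct
    show "?f (omult x y) = omult (?f x) (?f y)"
      by (cases x rule: prod.exhaust, cases y rule: prod.exhaust) (simp add: tw bil qmult_assoc qcnj_qmult qcnj_qcnj uu)
  qed
  moreover have "qtwist l (qmult qi q) = qmult qi (qtwist l q)" for q
    by (cases q rule: prod_cases4) (simp add: qtwist_def qi_def)
  then have "?f \<circ> tau = tau \<circ> ?f"
    by (simp add: fun_eq_iff tau_def case_prod_beta qmult_assoc)
  ultimately show ?thesis
    by (simp add: H4_def)
qed

lemma H4_matrix_surj:
  assumes A: "A \<in> carrier U2"
  shows "A \<in> H4_matrix ` H4"
proof -
  \<comment> \<open>The first column is the image of 1, so it must be \<open>u\<close>; the twist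
    parameter \<open>l\<close> is the determinant.\<close>
  define u where "u = quat_of (column 1 A)"
  define l where "l = det A"
  have AA: "cadjoint A ** A = mat 1"
    using A by (simp add: mem_U2)
  have e: "(\<Sum>k\<in>UNIV. cnj (A $ k $ r) * A $ k $ s) = (if r = s then 1 else 0)" for r s
    using arg_cong[OF AA, of "\<lambda>M. M $ r $ s"]
    by (simp add: matrix_matrix_mult_def cadjoint_def mat_def)
  have e11: "cnj (A$1$1) * A$1$1 + cnj (A$2$1) * A$2$1 = 1"
    and e12: "cnj (A$1$1) * A$1$2 + cnj (A$2$1) * A$2$2 = 0"
    and e22: "cnj (A$1$2) * A$1$2 + cnj (A$2$2) * A$2$2 = 1"
    using e[of 1 1] e[of 1 2] e[of 2 2] by (simp_all add: sum_2)
  have l_eq: "l = A$1$1 * A$2$2 - A$1$2 * A$2$1"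
    by (simp add: l_def det_2)
  \<comment> \<open>Unitarity determines the second column from the first column and the
    determinant; the identities combine \<open>e11\<close> and \<open>e12\<close> with suitable
    coefficients.\<close>
  have c12: "A$1$2 = - l * cnj (A$2$1)"
  proof -
    have "- l * cnj (A$2$1) = A$1$2 * (cnj (A$1$1) * A$1$1 + cnj (A$2$1) * A$2$1)
      - A$1$1 * (cnj (A$1$1) * A$1$2 + cnj (A$2$1) * A$2$2)"
      by (simp add: l_eq algebra_simps)
    then show ?thesis by (simp add: e11 e12)
  qed
  have c22: "A$2$2 = l * cnj (A$1$1)"
  proof -
    have "l * cnj (A$1$1) = A$2$2 * (cnj (A$1$1) * A$1$1 + cnj (A$2$1) * A$2$1)
      - A$2$1 * (cnj (A$1$1) * A$1$2 + cnj (A$2$1) * A$2$2)"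
      by (simp add: l_eq algebra_simps)
    then show ?thesis by (simp add: e11 e12)
  qed
  have "cnj l * l * (cnj (A$1$1) * A$1$1 + cnj (A$2$1) * A$2$1) = 1"
    using e22 by (simp add: c12 c22 algebra_simps)
  then have "cnj l * l = 1"
    by (simp add: e11)
  then have l: "(Re l)\<^sup>2 + (Im l)\<^sup>2 = 1"
    by (simp add: complex_eq_iff power2_eq_square)
  have u: "u \<bullet> u = 1"
    using e11 by (simp add: u_def quat_of_def column_def complex_eq_iff)
  define f where "f = (\<lambda>(p, q). (qmult (qcnj u) (qmult (qtwist l p) u), qmult (qtwist l q) u))"
  have f: "f \<in> H4"
    unfolding f_def using u l by (rule twist_in_H4)
  \<comment> \<open>Since j (a + b j) = - conj(b) + conj(a) j, the columns of \<open>A\<close> are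
    the coordinates of u and l j u.\<close>
  have "A *v cvec q = cvec (qmult (qtwist l q) u)" for q
    by (cases q rule: prod_cases4)
      (simp add: vec_eq_iff forall_2 matrix_vector_mult_def sum_2 cvec_nth u_def quat_of_def column_def
        qtwist_def c12 c22 complex_eq_iff algebra_simps)
  then have "A *v cvec q = H4_matrix f *v cvec q" for q
    by (simp add: H4_matrix_works[OF f]) (simp add: f_def)
  from this[of "quat_of _"] have "A = H4_matrix f"
    by (simp add: matrix_eq)
  with f show ?thesis by blast
qed

lemma H4_matrix_image: "H4_matrix ` H4 = carrier U2"
  using H4_matrix_in_U2 H4_matrix_surj by blast

section \<open>Topology\<close>

text \<open>Automorphisms are isometries, so \<open>carrier G2\<close> lies in a product of balls,
  compact by Tychonoff. The conditions of \<open>G2_iff\<close> are equations between values of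
  \<open>f\<close>, hence closed for pointwise convergence.\<close>

lemma compact_G2: "compact (carrier G2)"
proof -
  have "compactin (product_topology (\<lambda>i. euclidean) UNIV) (PiE UNIV (\<lambda>x :: oct. cball (0 :: oct) (norm x)))"
    by (simp add: compactin_PiE)
  then have "compact (PiE UNIV (\<lambda>x :: oct. cball (0 :: oct) (norm x)))"
    by (simp add: euclidean_product_topology)
  moreover have "closed {f :: oct \<Rightarrow> oct. (\<forall>x y. f (x + y) = f x + f y) \<and> (\<forall>c x. f (c *\<^sub>R x) = c *\<^sub>R f x) \<and>
      (\<forall>x y. f (omult x y) = omult (f x) (f y)) \<and> f o1 = o1}" (is "closed ?S")
    using bounded_bilinear.continuous_on[OF bilinear_omult[unfolded bilinear_conv_bounded_bilinear]
        continuous_on_product_coordinates continuous_on_product_coordinates]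
    by (intro closed_Collect_conj closed_Collect_all closed_Collect_eq continuous_intros
        continuous_on_product_coordinates) auto
  ultimately have "compact (PiE UNIV (\<lambda>x. cball 0 (norm x)) \<inter> ?S)"
    by (rule compact_Int_closed)
  moreover have "carrier G2 = PiE UNIV (\<lambda>x. cball 0 (norm x)) \<inter> ?S"
  proof (rule Set.set_eqI)
    fix f :: "oct \<Rightarrow> oct"
    have "f \<in> carrier G2 \<longleftrightarrow> f \<in> ?S"
      by (simp only: G2_iff linear_iff conj_assoc mem_Collect_eq)
    moreover have "f \<in> PiE UNIV (\<lambda>x. cball 0 (norm x))" if "f \<in> carrier G2"
      using G2_norm[OF that] by (simp add: PiE_UNIV_domain Pi_def)
    ultimately show "f \<in> carrier G2 \<longleftrightarrow> f \<in> PiE UNIV (\<lambda>x. cball 0 (norm x)) \<inter> ?S"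
      by blast
  qed
  ultimately show ?thesis
    by simp
qed

lemma compact_H4: "compact H4"
proof -
  have "closed {f :: oct \<Rightarrow> oct. \<forall>x. f (tau x) = tau (f x)}"
  proof (intro closed_Collect_all closed_Collect_eq)
    fix x
    show "continuous_on UNIV (\<lambda>f :: oct \<Rightarrow> oct. tau (f x))"
      using bounded_linear.continuous_on[OF G2D(1)[OF tau_in_G2, unfolded linear_conv_bounded_linear]
          continuous_on_product_coordinates] .
  qed simp
  then have "compact (carrier G2 \<inter> {f. \<forall>x. f (tau x) = tau (f x)})"
    by (rule compact_Int_closed[OF compact_G2])
  moreover have "H4 = carrier G2 \<inter> {f. \<forall>x. f (tau x) = tau (f x)}"
    by (simp add: H4_def fun_eq_iff Int_def)
  ultimately show ?thesis
    by (simp only:)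
qed

lemma continuous_on_H4_matrix: "continuous_on S H4_matrix"
proof -
  have "linear (\<lambda>x :: oct. cvec (snd x))"
    using linear_compose[OF linear_snd linear_cvec] by (simp add: o_def)
  then have "bounded_linear (\<lambda>x :: oct. cvec (snd x))"
    by (simp only: linear_conv_bounded_linear)
  from bounded_linear.continuous_on[OF this continuous_on_product_coordinates]
  have *: "continuous_on UNIV (\<lambda>f :: oct \<Rightarrow> oct. cvec (snd (f x)))" for x .
  have "continuous_on UNIV H4_matrix"
    unfolding H4_matrix_def matrix_def by (intro continuous_on_vec_lambda continuous_on_component *)
  then show ?thesis
    using continuous_on_subset by blast
qed

lemma H4_iso_U2: "H4_matrix \<in> iso (G2\<lparr>carrier := H4\<rparr>) U2"
proof -
  have "subgroup H4 G2"
    using group_action.stabilizer_subgroup[OF group_action_M4 base_in_M4] stabilizer_base by simp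
  then have "f \<circ> g \<in> H4" if "f \<in> H4" "g \<in> H4" for f g
    using subgroup.m_closed that by force
  then show ?thesis
    using H4_matrix_in_U2 H4_matrix_inj H4_matrix_image
    by (auto simp: iso_def hom_def bij_betw_def H4_matrix_comp U2_def)
qed

lemma H4_homeomorphic_U2: "homeomorphic_map (top_of_set H4) (top_of_set (carrier U2)) H4_matrix"
proof (rule continuous_imp_homeomorphic_map)
  show "continuous_map (top_of_set H4) (top_of_set (carrier U2)) H4_matrix"
    using continuous_on_H4_matrix H4_matrix_in_U2 by (auto simp: continuous_map_in_subtopology)
  show "compact_space (top_of_set H4)"
    using compact_H4 by (simp add: compact_space_subtopology)
  show "Hausdorff_space (top_of_set (carrier U2))"
    by (simp add: Hausdorff_space_subtopology)
  show "H4_matrix ` topspace (top_of_set H4) = topspace (top_of_set (carrier U2))"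
    using H4_matrix_image by simp
qed (simp add: H4_matrix_inj)

section \<open>The topology of \<open>M4\<close> and the orbit map\<close>

lemma oproj_eqI:
  assumes W: "subspace W" and w: "w \<in> W" "\<And>v. v \<in> W \<Longrightarrow> (x - w) \<bullet> v = 0"
  shows "oproj W x = w"
  unfolding oproj_def opol_inner
proof (rule the_equality)
  fix w' assume w': "w' \<in> W \<and> (\<forall>v\<in>W. (x - w') \<bullet> v = 0)"
  then have "w' - w \<in> W"
    using W w by (simp add: subspace_diff)
  then have "(w' - w) \<bullet> (w' - w) = (x - w) \<bullet> (w' - w) - (x - w') \<bullet> (w' - w)"
    by (simp add: algebra_simps)
  also have "\<dots> = 0"
    using w' w \<open>w' - w \<in> W\<close> by simp
  finally show "w' = w" by simp
qed (use w in simp)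

lemma oproj_mem:
  assumes W: "subspace W"
  shows "oproj W x \<in> W"
proof -
  obtain y z where yz: "y \<in> span W" "\<And>w. w \<in> span W \<Longrightarrow> orthogonal z w" "x = y + z"
    using orthogonal_subspace_decomp_exists[of W x] by metis
  then have y: "y \<in> W"
    using W by (simp add: span_eq_iff[THEN iffD2])
  have "oproj W x = y"
  proof (rule oproj_eqI[OF W y])
    fix v assume "v \<in> W"
    then show "(x - y) \<bullet> v = 0"
      using yz(2)[OF span_base] yz(3) by (simp add: orthogonal_def)
  qed
  then show ?thesis
    using y by simp
qed

lemma oproj_self: "subspace W \<Longrightarrow> x \<in> W \<Longrightarrow> oproj W x = x"
  by (rule oproj_eqI) simp_all

lemma topspace_M4_top: "topspace M4_top = M4"
  by (simp add: M4_top_def topspace_pullback_topology)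

text \<open>\<open>W\<close> consists of the values of \<open>oproj W\<close>, and the extensional
  \<open>J\<close> is recovered from \<open>J \<circ> oproj W\<close>, so \<open>M4\<close> maps
  injectively and continuously into a Hausdorff space.\<close>

lemma Hausdorff_space_M4_top: "Hausdorff_space M4_top"
proof (rule Hausdorff_space_injective_preimage)
  let ?F = "\<lambda>(W, J). (oproj W, J \<circ> oproj W)"
  have "Hausdorff_space (euclidean :: (oct \<Rightarrow> oct) topology)"
    using Hausdorff_space_product_topology[of "\<lambda>_ :: oct. euclidean :: oct topology" UNIV]
    by (simp add: euclidean_product_topology)
  then have "Hausdorff_space (prod_topology (euclidean :: (oct \<Rightarrow> oct) topology) (euclidean :: (oct \<Rightarrow> oct) topology))"
    by (simp add: Hausdorff_space_prod_topology del: prod_topology_euclidean)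
  then show "Hausdorff_space (euclidean :: ((oct \<Rightarrow> oct) \<times> (oct \<Rightarrow> oct)) topology)"
    by simp
  show "continuous_map M4_top euclidean ?F"
    unfolding M4_top_def using continuous_map_pullback[OF continuous_map_id, of M4 ?F euclidean]
    by (simp add: o_def)
  show "inj_on ?F (topspace M4_top)"
    unfolding topspace_M4_top
  proof (rule inj_onI, clarify)
    fix W J V K
    assume WJ: "(W, J) \<in> M4" and VK: "(V, K) \<in> M4" and eq: "oproj W = oproj V"
      and eq2: "J \<circ> oproj W = K \<circ> oproj V"
    have W: "subspace W" "J \<in> extensional W" and V: "subspace V" "K \<in> extensional V"
      using WJ VK End_on_extensional by (simp_all add: M4_iff)
    have WV: "W = V"
    proof (intro subset_antisym subsetI)
      show "x \<in> V" if "x \<in> W" for x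
        using oproj_mem[OF V(1), of x] oproj_self[OF W(1) that] eq by simp
      show "x \<in> W" if "x \<in> V" for x
        using oproj_mem[OF W(1), of x] oproj_self[OF V(1) that] eq by simp
    qed
    moreover have "J = K"
    proof (rule extensionalityI[OF W(2)])
      show "K \<in> extensional W" using V WV by simp
      fix x assume "x \<in> W"
      then show "J x = K x"
        using fun_cong[OF eq2, of x] oproj_self[OF W(1)] eq by simp
    qed
    ultimately show "W = V \<and> J = K" by simp
  qed
qed

text \<open>The conjugates of linear maps by \<open>f\<close> involve its inverse. Since
  \<open>f\<close> is orthogonal, the vectors \<open>f b\<close> form an orthonormal basis, and
  expanding in it expresses a conjugate by finitely many values of \<open>f\<close>.\<close>

lemma orbit_map_continuous:
  "continuous_map (top_of_set (carrier G2)) M4_top (\<lambda>f. M4_act f (Hl, J0))"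
  unfolding M4_top_def
proof (rule continuous_map_pullback')
  let ?F = "\<lambda>(W, J). (oproj W, J \<circ> oproj W)"
  have conj: "f (T (inv_into UNIV f x)) = (\<Sum>b\<in>Basis. (x \<bullet> f b) *\<^sub>R f (T b))"
    if f: "f \<in> carrier G2" and T: "linear T" for f T x
  proof -
    define y where "y = inv_into UNIV f x"
    have x: "x = f y"
      using G2D(2)[OF f] by (simp add: y_def bij_is_surj surj_f_inv_f)
    have "linear (f \<circ> T)"
      using T G2D(1)[OF f] by (rule linear_compose)
    then have "(f \<circ> T) (\<Sum>b\<in>Basis. (y \<bullet> b) *\<^sub>R b) = (\<Sum>b\<in>Basis. (y \<bullet> b) *\<^sub>R (f \<circ> T) b)"
      by (simp only: linear_sum linear_cmul)
    then have "f (T y) = (\<Sum>b\<in>Basis. (f y \<bullet> f b) *\<^sub>R f (T b))"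
      by (simp add: euclidean_representation G2_inner[OF f])
    from this[folded x, unfolded y_def] show ?thesis .
  qed
  \<comment> \<open>\<open>P\<close> is the projection onto H l and \<open>T\<close> is
    \<open>J0 \<circ> P\<close>; both are linear on all octonions, so \<open>conj\<close> applies to
    them.\<close>
  define P :: "oct \<Rightarrow> oct" where "P = (\<lambda>x. (0, snd x))"
  define T :: "oct \<Rightarrow> oct" where "T = (\<lambda>x. (0, qmult qi (snd x)))"
  have lin: "linear P" "linear T"
    by (rule linearI; simp add: P_def T_def qi_qmult_linear)+
  define R :: "(oct \<Rightarrow> oct) \<Rightarrow> (oct \<Rightarrow> oct) \<times> (oct \<Rightarrow> oct)" where
    "R f = (\<lambda>x. \<Sum>b\<in>Basis. (x \<bullet> f b) *\<^sub>R f (P b), \<lambda>x. \<Sum>b\<in>Basis. (x \<bullet> f b) *\<^sub>R f (T b))" for f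
  have "continuous_on UNIV R"
    unfolding R_def
    by (intro continuous_intros continuous_on_coordinatewise_then_product) auto
  then have R: "continuous_map (top_of_set (carrier G2)) euclidean R"
    using continuous_on_subset by auto
  have eq: "(?F \<circ> (\<lambda>f. M4_act f (Hl, J0))) f = R f" if f: "f \<in> carrier G2" for f
  proof -
    note fin = G2D(2)[OF f, THEN bij_is_surj, THEN surj_f_inv_f]
    have proj: "oproj (f ` Hl) x = f (P (inv_into UNIV f x))" for x
    proof (rule oproj_eqI[OF linear_subspace_image[OF G2D(1)[OF f] subspace_Hl]])
      define y where "y = inv_into UNIV f x"
      have x: "x = f y" by (simp add: y_def fin)
      show "f (P (inv_into UNIV f x)) \<in> f ` Hl"
        by (intro imageI) (simp add: P_def mem_Hl)
      fix v assume "v \<in> f ` Hl"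
      then obtain h where h: "h \<in> Hl" "v = f h" by blast
      have "(f y - f (P y)) \<bullet> f h = (y - P y) \<bullet> h"
        by (simp add: G2_inner[OF f] flip: linear_diff[OF G2D(1)[OF f]])
      also have "\<dots> = 0"
        using h by (simp add: P_def mem_Hl inner_prod_def)
      finally show "(x - f (P (inv_into UNIV f x))) \<bullet> v = 0"
        by (simp add: h flip: y_def) (simp add: x)
    qed
    have PT: "J0 (P y) = T y" for y
      by (simp add: P_def T_def)
    obtain V K where VK: "M4_act f (Hl, J0) = (V, K)" by fastforce
    then have "V = f ` Hl" by (simp add: M4_act_eq[OF base_in_M4])
    moreover have "K (f (P y)) = f (T y)" for y
      using M4_act_snd[OF base_in_M4 f, of "P y"] VK PT by (simp add: P_def mem_Hl)
    ultimately have "(?F \<circ> (\<lambda>f. M4_act f (Hl, J0))) f =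
        (\<lambda>x. f (P (inv_into UNIV f x)), \<lambda>x. f (T (inv_into UNIV f x)))"
      by (simp add: VK proj fun_eq_iff)
    also have "\<dots> = R f"
      by (simp only: R_def conj[OF f lin(1)] conj[OF f lin(2)])
    finally show ?thesis .
  qed
  show "continuous_map (top_of_set (carrier G2)) euclidean (?F \<circ> (\<lambda>f. M4_act f (Hl, J0)))"
    by (rule continuous_map_eq[OF R]) (simp only: topspace_euclidean_subtopology eq)
  show "topspace (top_of_set (carrier G2)) \<subseteq> (\<lambda>f. M4_act f (Hl, J0)) -` M4"
    using M4_act_closed[OF base_in_M4] by auto
qed

theorem mainTheorem5:
  shows "transitive_action G2 M4 M4_act \<and>
         (Hl, J0) \<in> M4 \<and>
         stabilizer G2 M4_act (Hl, J0) = H4 \<and>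
         (\<exists>\<psi>. \<psi> \<in> iso (G2\<lparr>carrier := H4\<rparr>) U2 \<and>
              homeomorphic_map (top_of_set H4) (top_of_set (carrier U2)) \<psi>) \<and>
         (\<exists>\<Phi>. bij_betw \<Phi> (lcosets\<^bsub>G2\<^esub> H4) M4 \<and>
              homeomorphic_map G2_mod_H4_top M4_top \<Phi> \<and>
              \<Phi> H4 = (Hl, J0) \<and>
              (\<forall>f\<in>carrier G2. \<forall>C\<in>lcosets\<^bsub>G2\<^esub> H4.
                 \<Phi> (f <#\<^bsub>G2\<^esub> C) = M4_act f (\<Phi> C)))"
proof -
  interpret transitive_action G2 M4 M4_act
    by (rule transitive_action_M4)
  interpret group G2
    by (rule group_G2)
  obtain \<Phi> where bij: "bij_betw \<Phi> (lcosets\<^bsub>G2\<^esub> H4) M4"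
    and val: "\<And>f. f \<in> carrier G2 \<Longrightarrow> \<Phi> (f <#\<^bsub>G2\<^esub> H4) = M4_act f (Hl, J0)"
    using orbit_stabilizer_bij[OF base_in_M4] unfolding stabilizer_base by blast
  have sub: "H4 \<subseteq> carrier G2"
    by (auto simp: H4_def)
  have cosets: "lcosets\<^bsub>G2\<^esub> H4 = (\<lambda>f. f <#\<^bsub>G2\<^esub> H4) ` carrier G2"
    by (auto simp: LCOSETS_def)
  \<comment> \<open>The orbit map of the base point factors through the coset map by
    \<open>\<Phi>\<close>.\<close>
  have "homeomorphic_map G2_mod_H4_top M4_top \<Phi>"
    unfolding G2_mod_H4_top_def
  proof (rule homeomorphic_map_quotient_topology)
    show "compact_space (top_of_set (carrier G2))"
      using compact_G2 by (simp add: compact_space_subtopology)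
    show "(\<lambda>f. M4_act f (Hl, J0)) ` topspace (top_of_set (carrier G2)) = topspace M4_top"
      using bij val by (simp add: topspace_M4_top bij_betw_def cosets image_image cong: image_cong)
    show "inj_on \<Phi> ((\<lambda>f. f <#\<^bsub>G2\<^esub> H4) ` topspace (top_of_set (carrier G2)))"
      using bij by (simp add: bij_betw_def cosets)
  qed (use val Hausdorff_space_M4_top orbit_map_continuous in simp_all)
  moreover have "\<Phi> H4 = (Hl, J0)"
    using val[OF one_closed] lcos_mult_one[OF sub] M4_act_id[OF base_in_M4] by simp
  moreover have "\<forall>f\<in>carrier G2. \<forall>C\<in>lcosets\<^bsub>G2\<^esub> H4. \<Phi> (f <#\<^bsub>G2\<^esub> C) = M4_act f (\<Phi> C)"
  proof (intro ballI)
    fix f C assume f: "f \<in> carrier G2" and "C \<in> lcosets\<^bsub>G2\<^esub> H4"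
    then obtain g where g: "g \<in> carrier G2" "C = g <#\<^bsub>G2\<^esub> H4"
      by (auto simp: cosets)
    \<comment> \<open>Writing \<open>C\<close> as the coset of \<open>g\<close> reduces equivariance
      to the composition rule at the base point.\<close>
    then have "\<Phi> (f <#\<^bsub>G2\<^esub> C) = M4_act (f \<otimes>\<^bsub>G2\<^esub> g) (Hl, J0)"
      using lcos_m_assoc[OF sub f g(1)] val[OF m_closed[OF f g(1)]] by simp
    then show "\<Phi> (f <#\<^bsub>G2\<^esub> C) = M4_act f (\<Phi> C)"
      using composition_rule[OF base_in_M4 f g(1)] g val by simp
  qed
  ultimately show ?thesis
    using transitive_action_M4 base_in_M4 stabilizer_base H4_iso_U2 H4_homeomorphic_U2 bij by blast
qed

end
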